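(* Let $2<p<\infty$ and let $q$ be the conjugate exponent, $1/p+1/q=1$. Let $(x_n)_{n\in\mathbb N}$ be a normalized block sequence in $JT_{2,p}$ such that $\lim_n\|x_n|_\sigma\|=0$ for every branch $\sigma$ of $\mathcal T$. Then there exists a subsequence of $(x_n)_n$ that is equivalent to the unit vector basis of $\ell_p$. In particular, for every $\varepsilon>0$ there exists a subsequence of $(x_n)_n$ which is $(2^{1/q}+\varepsilon)$-equivalent to the unit vector basis of $\ell_p$.
   Context: $\mathbb N=\{1,2,\dots\}$. Fix a partial order $\preceq$ on $\mathbb N$, compatible with the usual order ($n\preceq m$ implies $n\le m$), defining an infinitely branching tree without root: the predecessors of each element are linearly ordered, there are infinitely many minimal elements, and every element has infinitely many immediate successors. $\mathcal T$ denotes this tree with the empty set added as a root. A segment is a set $\{k\in\mathbb N: m\preceq k\preceq n\}$ with $m\preceq n$; a branch is a maximal linearly ordered subset of $\mathbb N$. $c_{00}(\mathbb N)$ is the space of finitely supported real sequences with unit vectors $e_n$. For $2<p<\infty$, $JT_{2,p}$ is the completion of $c_{00}(\mathbb N)$ under the norm $$\|x\|=\sup\Big\{\Big(\sum_{k=1}^n\Big(\sum_{i\in s_k}x(i)^2\Big)^{p/2}\Big)^{1/p}: n\in\mathbb N,\ s_1,\dots,s_n \text{ pairwise disjoint segments}\Big\}.$$ The sequence $(e_n)_n$ is a $1$-unconditional Schauder basis of $JT_{2,p}$; for $x=\sum_n x(n)e_n$ and $A\subset\mathbb N$, $x|_A=\sum_{n\in A}x(n)e_n$. A block sequence is a sequence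 of nonzero finitely supported vectors with $\max\operatorname{supp}x_n<\min\operatorname{supp}x_{n+1}$ for all $n$. Two sequences $(x_n)$, $(z_n)$ are $C$-equivalent if there are $A,B>0$ with $AB\le C$ and $A^{-1}\|\sum a_nz_n\|\le\|\sum a_nx_n\|\le B\|\sum a_nz_n\|$ for all finitely supported real $(a_n)$; equivalent means $C$-equivalent for some $C$. *)

theory Defs
  imports "HOL-Analysis.Analysis" "HOL-Library.Disjoint_Sets"
begin

text \<open>
  The index set \<open>{1, 2, ...}\<close> is represented by the type \<^typ>\<open>nat\<close>, which starts at \<open>0\<close>; only its
  order and its infinitude are used.  A tree order is a relation \<open>r\<close> on \<^typ>\<open>nat\<close>, and
  \<open>(m, n) \<in> r\<close> stands for \<open>m \<preceq> n\<close>.  Scalar sequences are functions \<^typ>\<open>nat \<Rightarrow> real\<close>.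
\<close>

definition immediate_successor :: "nat rel \<Rightarrow> nat \<Rightarrow> nat \<Rightarrow> bool" where
  "immediate_successor r m n \<longleftrightarrow>
     (m, n) \<in> r \<and> m \<noteq> n \<and> (\<forall>k. (m, k) \<in> r \<and> (k, n) \<in> r \<longrightarrow> k = m \<or> k = n)"

definition minimal_nodes :: "nat rel \<Rightarrow> nat set" where
  "minimal_nodes r = {n. \<forall>m. (m, n) \<in> r \<longrightarrow> m = n}"

text \<open>
  Infinitely branching trees without root.  The empty set that is adjoined as a root lies in no
  segment and in no branch, so it plays no role below.
\<close>

definition inf_branching_tree :: "nat rel \<Rightarrow> bool" where
  "inf_branching_tree r \<longleftrightarrow>
     partial_order_on UNIV r \<and>
     (\<forall>n m. (n, m) \<in> r \<longrightarrow> n \<le> m) \<and>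
     (\<forall>n. {m. (m, n) \<in> r} \<in> Chains r) \<and>
     infinite (minimal_nodes r) \<and>
     (\<forall>m. infinite {n. immediate_successor r m n})"

definition segments :: "nat rel \<Rightarrow> nat set set" where
  "segments r = {{k. (m, k) \<in> r \<and> (k, n) \<in> r} | m n. (m, n) \<in> r}"

definition branches :: "nat rel \<Rightarrow> nat set set" where
  "branches r = {\<sigma> \<in> Chains r. \<forall>\<tau> \<in> Chains r. \<sigma> \<subseteq> \<tau> \<longrightarrow> \<tau> = \<sigma>}"

definition supp :: "(nat \<Rightarrow> real) \<Rightarrow> nat set" where
  "supp x = {i. x i \<noteq> 0}"

definition c00 :: "(nat \<Rightarrow> real) set" where
  "c00 = {x. finite (supp x)}"

definition unit_vec :: "nat \<Rightarrow> nat \<Rightarrow> real" where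
  "unit_vec n = (\<lambda>i. if i = n then 1 else 0)"

definition restr :: "(nat \<Rightarrow> real) \<Rightarrow> nat set \<Rightarrow> nat \<Rightarrow> real" where
  "restr x A = (\<lambda>i. if i \<in> A then x i else 0)"

text \<open>
  Segments are nonempty, so a finite family of pairwise disjoint segments is the same thing as a
  finite set of segments that is disjoint.
\<close>

definition disjoint_segments :: "nat rel \<Rightarrow> nat set set set" where
  "disjoint_segments r = {S. finite S \<and> S \<noteq> {} \<and> S \<subseteq> segments r \<and> disjoint S}"

definition JT_sum :: "real \<Rightarrow> nat set set \<Rightarrow> (nat \<Rightarrow> real) \<Rightarrow> real" where
  "JT_sum p S x = (\<Sum>s\<in>S. (\<Sum>i\<in>s. (x i)\<^sup>2) powr (p / 2)) powr (1 / p)"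

definition JT_bounded :: "nat rel \<Rightarrow> real \<Rightarrow> (nat \<Rightarrow> real) set" where
  "JT_bounded r p = {x. bdd_above ((\<lambda>S. JT_sum p S x) ` disjoint_segments r)}"

text \<open>Meaningful on \<^term>\<open>JT_bounded r p\<close> only, where the supremum is finite.\<close>

definition JT_norm :: "nat rel \<Rightarrow> real \<Rightarrow> (nat \<Rightarrow> real) \<Rightarrow> real" where
  "JT_norm r p x = (SUP S\<in>disjoint_segments r. JT_sum p S x)"

text \<open>
  The completion of \<^term>\<open>c00\<close> under \<^term>\<open>JT_norm r p\<close>, realised as the closure of \<^term>\<open>c00\<close> in
  the space of all sequences of finite norm.  The lemmas at the end of this theory show that this
  is a complete normed space in which \<^term>\<open>c00\<close> is dense.
\<close>

definition JT :: "nat rel \<Rightarrow> real \<Rightarrow> (nat \<Rightarrow> real) set" where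
  "JT r p = {x \<in> JT_bounded r p. \<forall>\<epsilon>>0. \<exists>y\<in>c00. JT_norm r p (\<lambda>i. x i - y i) < \<epsilon>}"

definition lp_norm :: "real \<Rightarrow> (nat \<Rightarrow> real) \<Rightarrow> real" where
  "lp_norm p x = (\<Sum>i. \<bar>x i\<bar> powr p) powr (1 / p)"

definition block_sequence :: "(nat \<Rightarrow> nat \<Rightarrow> real) \<Rightarrow> bool" where
  "block_sequence x \<longleftrightarrow>
     (\<forall>n. x n \<in> c00 \<and> supp (x n) \<noteq> {} \<and> Max (supp (x n)) < Min (supp (x (Suc n))))"

definition lincomb :: "(nat \<Rightarrow> real) \<Rightarrow> (nat \<Rightarrow> nat \<Rightarrow> real) \<Rightarrow> nat \<Rightarrow> real" where
  "lincomb a x = (\<lambda>i. \<Sum>n\<in>supp a. a n * x n i)"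

text \<open>
  \<open>x\<close> is a sequence in a sequence space with norm \<open>N\<close>, and \<open>z\<close> is a sequence in a sequence space
  with norm \<open>M\<close>.
\<close>

definition C_equivalent ::
  "real \<Rightarrow> ((nat \<Rightarrow> real) \<Rightarrow> real) \<Rightarrow> (nat \<Rightarrow> nat \<Rightarrow> real) \<Rightarrow>
   ((nat \<Rightarrow> real) \<Rightarrow> real) \<Rightarrow> (nat \<Rightarrow> nat \<Rightarrow> real) \<Rightarrow> bool" where
  "C_equivalent C N x M z \<longleftrightarrow>
     (\<exists>A>0. \<exists>B>0. A * B \<le> C \<and>
       (\<forall>a\<in>c00. inverse A * M (lincomb a z) \<le> N (lincomb a x) \<and>
                N (lincomb a x) \<le> B * M (lincomb a z)))"

definition equivalent_seq ::
  "((nat \<Rightarrow> real) \<Rightarrow> real) \<Rightarrow> (nat \<Rightarrow> nat \<Rightarrow> real) \<Rightarrow>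
   ((nat \<Rightarrow> real) \<Rightarrow> real) \<Rightarrow> (nat \<Rightarrow> nat \<Rightarrow> real) \<Rightarrow> bool" where
  "equivalent_seq N x M z \<longleftrightarrow> (\<exists>C. C_equivalent C N x M z)"


subsection \<open>\<^term>\<open>JT r p\<close> is a completion of \<^term>\<open>c00\<close>\<close>

lemma powr_convex_comb:
  fixes x y t p :: real
  assumes "p \<ge> 1" "x \<ge> 0" "y \<ge> 0" "0 < t" "t < 1"
  shows "(t * x + (1 - t) * y) powr p \<le> t * x powr p + (1 - t) * y powr p"
proof -
  have le: "s powr p \<le> s" if "0 \<le> s" "s \<le> 1" for s :: real
    using powr_mono'[of 1 p s] that assms(1) by (cases "s = 0") auto
  consider "x = 0" | "y = 0" | "x > 0" "y > 0" using assms by linarith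
  then show ?thesis
  proof cases
    case 1
    have "((1 - t) * y) powr p \<le> (1 - t) * y powr p"
      using le[of "1 - t"] assms by (simp add: powr_mult mult_right_mono)
    then show ?thesis using 1 assms by simp
  next
    case 2
    have "(t * x) powr p \<le> t * x powr p"
      using le[of t] assms by (simp add: powr_mult mult_right_mono)
    then show ?thesis using 2 assms by simp
  next
    case 3
    show ?thesis
      using convex_onD[OF powr_convex[OF assms(1)], of "1 - t" x y] 3 assms by simp
  qed
qed

lemma minkowski_powr:
  fixes a b :: "'a \<Rightarrow> real"
  assumes p: "p \<ge> 1" and fin: "finite S"
    and a: "\<And>s. s \<in> S \<Longrightarrow> 0 \<le> a s" and b: "\<And>s. s \<in> S \<Longrightarrow> 0 \<le> b s"
  shows "(\<Sum>s\<in>S. (a s + b s) powr p) powr (1 / p)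
       \<le> (\<Sum>s\<in>S. a s powr p) powr (1 / p) + (\<Sum>s\<in>S. b s powr p) powr (1 / p)"
proof -
  define u where "u = (\<Sum>s\<in>S. a s powr p) powr (1 / p)"
  define v where "v = (\<Sum>s\<in>S. b s powr p) powr (1 / p)"
  have sa: "(\<Sum>s\<in>S. a s powr p) = u powr p" and sb: "(\<Sum>s\<in>S. b s powr p) = v powr p"
    using p by (simp_all add: u_def v_def powr_powr sum_nonneg)
  have uv: "u \<ge> 0" "v \<ge> 0" by (simp_all add: u_def v_def)
  consider "u = 0" | "v = 0" | "u > 0" "v > 0" using uv by linarith
  then have "(\<Sum>s\<in>S. (a s + b s) powr p) powr (1 / p) \<le> u + v"
  proof cases
    case 1
    then have "\<forall>s\<in>S. a s powr p = 0"
      using sa p fin by (simp add: sum_nonneg_eq_0_iff)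
    then have "(\<Sum>s\<in>S. (a s + b s) powr p) = (\<Sum>s\<in>S. b s powr p)"
      by (intro sum.cong) auto
    then show ?thesis using 1 by (simp add: v_def)
  next
    case 2
    then have "\<forall>s\<in>S. b s powr p = 0"
      using sb p fin by (simp add: sum_nonneg_eq_0_iff)
    then have "(\<Sum>s\<in>S. (a s + b s) powr p) = (\<Sum>s\<in>S. a s powr p)"
      by (intro sum.cong) auto
    then show ?thesis using 2 by (simp add: u_def)
  next
    case 3
    define t where "t = u / (u + v)"
    have t: "0 < t" "t < 1" and t': "1 - t = v / (u + v)"
      using 3 by (simp_all add: t_def field_simps)
    have "(a s + b s) powr p
        \<le> (u + v) powr p * (t * (a s powr p / u powr p) + (1 - t) * (b s powr p / v powr p))"
      if s: "s \<in> S" for s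
    proof -
      have "t * (a s / u) + (1 - t) * (b s / v) = a s / (u + v) + b s / (u + v)"
        unfolding t' unfolding t_def using 3 by simp
      then have "a s + b s = (u + v) * (t * (a s / u) + (1 - t) * (b s / v))"
        using 3 by (simp add: add_divide_distrib[symmetric])
      then have "(a s + b s) powr p
          = (u + v) powr p * (t * (a s / u) + (1 - t) * (b s / v)) powr p"
        using 3 t a[OF s] b[OF s] by (simp add: powr_mult)
      also have "\<dots> \<le> (u + v) powr p * (t * (a s / u) powr p + (1 - t) * (b s / v) powr p)"
        using powr_convex_comb[OF p _ _ t, of "a s / u" "b s / v"] a[OF s] b[OF s] 3
        by (intro mult_left_mono) auto
      finally show ?thesis using a[OF s] b[OF s] 3 by (simp add: powr_divide)
    qed
    then have "(\<Sum>s\<in>S. (a s + b s) powr p)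
        \<le> (\<Sum>s\<in>S. (u + v) powr p *
            (t * (a s powr p / u powr p) + (1 - t) * (b s powr p / v powr p)))"
      by (rule sum_mono)
    also have "\<dots> = (u + v) powr p * (t * ((\<Sum>s\<in>S. a s powr p) / u powr p)
                     + (1 - t) * ((\<Sum>s\<in>S. b s powr p) / v powr p))"
      unfolding sum_divide_distrib sum_distrib_left sum.distrib[symmetric] by simp
    also have "\<dots> = (u + v) powr p"
      unfolding sa sb using 3 by simp
    finally have "(\<Sum>s\<in>S. (a s + b s) powr p) powr (1 / p) \<le> ((u + v) powr p) powr (1 / p)"
      using p by (intro powr_mono2) (auto intro: sum_nonneg)
    then show ?thesis using p 3 by (simp add: powr_powr)
  qed
  then show ?thesis by (simp add: u_def v_def)
qed

lemma JT_sum_alt: "JT_sum p S x = (\<Sum>s\<in>S. L2_set x s powr p) powr (1 / p)"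
proof -
  have "(\<Sum>i\<in>s. (x i)\<^sup>2) powr (p / 2) = L2_set x s powr p" for s
    by (simp add: L2_set_def powr_half_sqrt[symmetric] sum_nonneg powr_powr)
  then show ?thesis by (simp add: JT_sum_def)
qed

lemma JT_sum_nonneg: "0 \<le> JT_sum p S x"
  by (simp add: JT_sum_def)

lemma JT_sum_triangle:
  assumes "p \<ge> 1" "finite S"
  shows "JT_sum p S (\<lambda>i. x i + y i) \<le> JT_sum p S x + JT_sum p S y"
proof -
  have "JT_sum p S (\<lambda>i. x i + y i) \<le> (\<Sum>s\<in>S. (L2_set x s + L2_set y s) powr p) powr (1 / p)"
    unfolding JT_sum_alt using assms
    by (intro powr_mono2 sum_mono L2_set_triangle_ineq) (auto intro: sum_nonneg)
  also have "\<dots> \<le> JT_sum p S x + JT_sum p S y"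
    unfolding JT_sum_alt using assms by (intro minkowski_powr) auto
  finally show ?thesis .
qed

lemma JT_sum_scale:
  assumes "p \<ge> 1"
  shows "JT_sum p S (\<lambda>i. c * x i) = \<bar>c\<bar> * JT_sum p S x"
proof -
  have "L2_set (\<lambda>i. c * x i) s = \<bar>c\<bar> * L2_set x s" for s
    by (simp add: L2_set_def power_mult_distrib sum_distrib_left[symmetric] real_sqrt_mult)
  then have "JT_sum p S (\<lambda>i. c * x i) = (\<bar>c\<bar> powr p * (\<Sum>s\<in>S. L2_set x s powr p)) powr (1 / p)"
    by (simp add: JT_sum_alt powr_mult sum_distrib_left)
  also have "\<dots> = \<bar>c\<bar> * JT_sum p S x"
    using assms by (simp add: JT_sum_alt powr_mult powr_powr sum_nonneg)
  finally show ?thesis .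
qed

lemma finite_segment: "inf_branching_tree r \<Longrightarrow> s \<in> segments r \<Longrightarrow> finite s"
  unfolding inf_branching_tree_def segments_def
  by (auto intro: finite_subset[of _ "{.._}"])

lemma singleton_disjoint_segments:
  assumes "inf_branching_tree r"
  shows "{{i}} \<in> disjoint_segments r"
proof -
  have po: "partial_order_on UNIV r" using assms by (simp add: inf_branching_tree_def)
  then have "(i, i) \<in> r" and "{k. (i, k) \<in> r \<and> (k, i) \<in> r} = {i}"
    by (auto simp: partial_order_on_def preorder_on_def refl_on_def antisym_def)
  then have "{i} \<in> segments r" unfolding segments_def by blast
  then show ?thesis by (simp add: disjoint_segments_def)
qed

lemma JT_sum_le_norm:
  "x \<in> JT_bounded r p \<Longrightarrow> S \<in> disjoint_segments r \<Longrightarrow> JT_sum p S x \<le> JT_norm r p x"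
  unfolding JT_bounded_def JT_norm_def by (auto intro: cSUP_upper)

lemma JT_norm_le:
  assumes "inf_branching_tree r" "\<And>S. S \<in> disjoint_segments r \<Longrightarrow> JT_sum p S x \<le> c"
  shows "x \<in> JT_bounded r p" "JT_norm r p x \<le> c"
proof -
  show "x \<in> JT_bounded r p"
    unfolding JT_bounded_def mem_Collect_eq by (rule bdd_aboveI2) (rule assms(2))
  show "JT_norm r p x \<le> c"
    unfolding JT_norm_def using singleton_disjoint_segments[OF assms(1)] assms(2)
    by (intro cSUP_least) auto
qed

lemma JT_norm_coord:
  assumes "inf_branching_tree r" "p \<ge> 1" "x \<in> JT_bounded r p"
  shows "\<bar>x i\<bar> \<le> JT_norm r p x"
  using JT_sum_le_norm[OF assms(3) singleton_disjoint_segments[OF assms(1)], of i] assms(2)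
  by (simp add: JT_sum_alt powr_powr)

lemma JT_bounded_add:
  assumes "inf_branching_tree r" "p \<ge> 1" "x \<in> JT_bounded r p" "y \<in> JT_bounded r p"
  shows "(\<lambda>i. x i + y i) \<in> JT_bounded r p"
    "JT_norm r p (\<lambda>i. x i + y i) \<le> JT_norm r p x + JT_norm r p y"
proof -
  have "JT_sum p S (\<lambda>i. x i + y i) \<le> JT_norm r p x + JT_norm r p y"
    if "S \<in> disjoint_segments r" for S
    using JT_sum_triangle[OF assms(2), of S x y] JT_sum_le_norm[OF assms(3) that]
      JT_sum_le_norm[OF assms(4) that] that by (simp add: disjoint_segments_def)
  from JT_norm_le[OF assms(1) this]
  show "(\<lambda>i. x i + y i) \<in> JT_bounded r p"
    "JT_norm r p (\<lambda>i. x i + y i) \<le> JT_norm r p x + JT_norm r p y" by blast+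
qed

lemma JT_bounded_scale:
  assumes "inf_branching_tree r" "p \<ge> 1" "x \<in> JT_bounded r p"
  shows "(\<lambda>i. c * x i) \<in> JT_bounded r p" "JT_norm r p (\<lambda>i. c * x i) = \<bar>c\<bar> * JT_norm r p x"
proof -
  have le: "(\<lambda>i. c * x i) \<in> JT_bounded r p \<and> JT_norm r p (\<lambda>i. c * x i) \<le> \<bar>c\<bar> * JT_norm r p x"
    if "x \<in> JT_bounded r p" for c x
  proof -
    have "JT_sum p S (\<lambda>i. c * x i) \<le> \<bar>c\<bar> * JT_norm r p x" if "S \<in> disjoint_segments r" for S
      using JT_sum_le_norm[OF \<open>x \<in> JT_bounded r p\<close> that]
      by (simp add: JT_sum_scale[OF assms(2)] mult_left_mono)
    from JT_norm_le[OF assms(1) this] show ?thesis by blast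
  qed
  show *: "(\<lambda>i. c * x i) \<in> JT_bounded r p" using le[OF assms(3)] by blast
  show "JT_norm r p (\<lambda>i. c * x i) = \<bar>c\<bar> * JT_norm r p x"
  proof (cases "c = 0")
    case True
    have "0 \<le> JT_norm r p (\<lambda>i. c * x i)"
      using JT_norm_coord[OF assms(1,2) *, of 0] by linarith
    then show ?thesis using le[OF assms(3), of c] True by simp
  next
    case False
    have "JT_norm r p (\<lambda>i. inverse c * (c * x i)) \<le> \<bar>inverse c\<bar> * JT_norm r p (\<lambda>i. c * x i)"
      using le[OF *] by blast
    moreover have "(\<lambda>i. inverse c * (c * x i)) = x"
      using False by (simp add: mult.assoc[symmetric])
    ultimately have "\<bar>c\<bar> * JT_norm r p x \<le> JT_norm r p (\<lambda>i. c * x i)"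
      using False by (simp add: field_simps)
    then show ?thesis using le[OF assms(3), of c] by linarith
  qed
qed

lemma JT_bounded_diff:
  assumes "inf_branching_tree r" "p \<ge> 1" "x \<in> JT_bounded r p" "y \<in> JT_bounded r p"
  shows "(\<lambda>i. x i - y i) \<in> JT_bounded r p"
    "JT_norm r p (\<lambda>i. x i - y i) \<le> JT_norm r p x + JT_norm r p y"
  using JT_bounded_add[OF assms(1-3) JT_bounded_scale(1)[OF assms(1,2,4), of "- 1"]]
    JT_bounded_scale(2)[OF assms(1,2,4), of "- 1"] by simp_all

lemma c00_subset_JT_bounded:
  assumes tree: "inf_branching_tree r" and p: "p \<ge> 1"
  shows "c00 \<subseteq> JT_bounded r p"
proof
  fix x assume "x \<in> c00"
  then have fin: "finite (supp x)" by (simp add: c00_def)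
  define c where "c = (\<Sum>i\<in>supp x. \<bar>x i\<bar>)"
  show "x \<in> JT_bounded r p"
  proof (rule JT_norm_le(1)[OF tree])
    fix S assume S: "S \<in> disjoint_segments r"
    then have fS: "finite S" and fs: "\<And>s. s \<in> S \<Longrightarrow> finite s" and dis: "disjoint S"
      using finite_segment[OF tree] by (auto simp: disjoint_segments_def)
    have l: "L2_set x s \<le> (\<Sum>i\<in>s \<inter> supp x. \<bar>x i\<bar>)" if "s \<in> S" for s
    proof -
      have "L2_set x s \<le> (\<Sum>i\<in>s. \<bar>x i\<bar>)" by (rule L2_set_le_sum_abs)
      also have "\<dots> = (\<Sum>i\<in>s \<inter> supp x. \<bar>x i\<bar>)"
        using fs[OF that] by (intro sum.mono_neutral_right) (auto simp: supp_def)
      finally show ?thesis .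
    qed
    have l': "L2_set x s \<le> c" if "s \<in> S" for s
      using l[OF that] fin unfolding c_def
      by (meson Int_lower2 abs_ge_zero order_trans sum_mono2)
    have c0: "c \<ge> 0" by (simp add: c_def sum_nonneg)
    have "(\<Sum>s\<in>S. L2_set x s powr p) \<le> (\<Sum>s\<in>S. (\<Sum>i\<in>s \<inter> supp x. \<bar>x i\<bar>) * c powr (p - 1))"
    proof (rule sum_mono)
      fix s assume s: "s \<in> S"
      have "L2_set x s powr p = L2_set x s * L2_set x s powr (p - 1)"
        using powr_mult_base[of "L2_set x s" "p - 1"] by simp
      also have "\<dots> \<le> (\<Sum>i\<in>s \<inter> supp x. \<bar>x i\<bar>) * c powr (p - 1)"
        using l[OF s] l'[OF s] p by (intro mult_mono powr_mono2) (auto intro: sum_nonneg)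
      finally show "L2_set x s powr p \<le> (\<Sum>i\<in>s \<inter> supp x. \<bar>x i\<bar>) * c powr (p - 1)" .
    qed
    also have "\<dots> = (\<Sum>s\<in>S. \<Sum>i\<in>s \<inter> supp x. \<bar>x i\<bar>) * c powr (p - 1)"
      by (simp add: sum_distrib_right)
    also have "(\<Sum>s\<in>S. \<Sum>i\<in>s \<inter> supp x. \<bar>x i\<bar>) = (\<Sum>i\<in>(\<Union>s\<in>S. s \<inter> supp x). \<bar>x i\<bar>)"
      using fS fs dis
      by (intro sum.UNION_disjoint[symmetric]) (auto simp: disjoint_def)
    also have "\<dots> \<le> c" unfolding c_def using fin by (intro sum_mono2) auto
    finally have "(\<Sum>s\<in>S. L2_set x s powr p) \<le> c * c powr (p - 1)"
      by (simp add: mult_right_mono)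
    then show "JT_sum p S x \<le> (c * c powr (p - 1)) powr (1 / p)"
      unfolding JT_sum_alt using p by (intro powr_mono2) (auto intro: sum_nonneg)
  qed
qed

lemma JT_norm_zero: "inf_branching_tree r \<Longrightarrow> p \<ge> 1 \<Longrightarrow> JT_norm r p (\<lambda>i. 0) = 0"
  using JT_bounded_scale(2)[of r p "\<lambda>i. 0" 0] subsetD[OF c00_subset_JT_bounded, of r p "\<lambda>i. 0"]
  by (simp add: c00_def supp_def)

lemma c00_subset_JT:
  assumes "inf_branching_tree r" "p \<ge> 1"
  shows "c00 \<subseteq> JT r p"
proof
  fix x assume x: "x \<in> c00"
  have "\<exists>y\<in>c00. JT_norm r p (\<lambda>i. x i - y i) < \<epsilon>" if "\<epsilon> > 0" for \<epsilon>
    using x that JT_norm_zero[OF assms] by (intro bexI[of _ x]) auto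
  then show "x \<in> JT r p" using x c00_subset_JT_bounded[OF assms] by (auto simp: JT_def)
qed

lemma c00_dense_JT:
  "x \<in> JT r p \<Longrightarrow> \<epsilon> > 0 \<Longrightarrow> \<exists>y\<in>c00. JT_norm r p (\<lambda>i. x i - y i) < \<epsilon>"
  by (simp add: JT_def)

lemma JT_norm_eq_0_iff:
  assumes "inf_branching_tree r" "p \<ge> 1" "x \<in> JT r p"
  shows "JT_norm r p x = 0 \<longleftrightarrow> x = (\<lambda>i. 0)"
proof
  assume "JT_norm r p x = 0"
  then show "x = (\<lambda>i. 0)"
    using JT_norm_coord[OF assms(1,2), of x] assms(3) by (auto simp: JT_def)
qed (simp add: JT_norm_zero assms)

lemma JT_norm_triangle:
  assumes "inf_branching_tree r" "p \<ge> 1" "x \<in> JT r p" "y \<in> JT r p"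
  shows "JT_norm r p (\<lambda>i. x i + y i) \<le> JT_norm r p x + JT_norm r p y"
  using JT_bounded_add[OF assms(1,2)] assms(3,4) by (auto simp: JT_def)

lemma JT_norm_scale:
  assumes "inf_branching_tree r" "p \<ge> 1" "x \<in> JT r p"
  shows "JT_norm r p (\<lambda>i. c * x i) = \<bar>c\<bar> * JT_norm r p x"
  using JT_bounded_scale[OF assms(1,2)] assms(3) by (auto simp: JT_def)

lemma JT_add:
  assumes "inf_branching_tree r" "p \<ge> 1" "x \<in> JT r p" "y \<in> JT r p"
  shows "(\<lambda>i. x i + y i) \<in> JT r p"
proof -
  note b = c00_subset_JT_bounded[OF assms(1,2)]
  have xy: "x \<in> JT_bounded r p" "y \<in> JT_bounded r p" using assms by (auto simp: JT_def)
  have "\<exists>w\<in>c00. JT_norm r p (\<lambda>i. (x i + y i) - w i) < \<epsilon>" if e: "\<epsilon> > 0" for \<epsilon>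
  proof -
    obtain u v where u: "u \<in> c00" "JT_norm r p (\<lambda>i. x i - u i) < \<epsilon> / 2"
      and v: "v \<in> c00" "JT_norm r p (\<lambda>i. y i - v i) < \<epsilon> / 2"
      using c00_dense_JT[OF assms(3), of "\<epsilon> / 2"] c00_dense_JT[OF assms(4), of "\<epsilon> / 2"] e by auto
    have w: "(\<lambda>i. u i + v i) \<in> c00"
      using u v by (auto simp: c00_def supp_def intro: finite_subset[of _ "supp u \<union> supp v"])
    have "JT_norm r p (\<lambda>i. (x i - u i) + (y i - v i)) < \<epsilon>"
      using JT_bounded_add(2)[OF assms(1,2) JT_bounded_diff(1)[OF assms(1,2) xy(1), of u]
          JT_bounded_diff(1)[OF assms(1,2) xy(2), of v]] u v
          subsetD[OF b u(1)] subsetD[OF b v(1)] by simp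
    also have "(\<lambda>i. (x i - u i) + (y i - v i)) = (\<lambda>i. (x i + y i) - (u i + v i))"
      by (auto simp: algebra_simps)
    finally show ?thesis using w by (intro bexI[of _ "\<lambda>i. u i + v i"]) auto
  qed
  then show ?thesis using JT_bounded_add(1)[OF assms(1,2) xy] by (auto simp: JT_def)
qed

lemma JT_scale:
  assumes "inf_branching_tree r" "p \<ge> 1" "x \<in> JT r p"
  shows "(\<lambda>i. c * x i) \<in> JT r p"
proof (cases "c = 0")
  case True
  then show ?thesis
    using c00_subset_JT[OF assms(1,2)] by (auto simp: c00_def supp_def)
next
  case False
  have x: "x \<in> JT_bounded r p" using assms by (auto simp: JT_def)
  have "\<exists>w\<in>c00. JT_norm r p (\<lambda>i. c * x i - w i) < \<epsilon>" if e: "\<epsilon> > 0" for \<epsilon>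
  proof -
    obtain u where u: "u \<in> c00" "JT_norm r p (\<lambda>i. x i - u i) < \<epsilon> / \<bar>c\<bar>"
      using c00_dense_JT[OF assms(3), of "\<epsilon> / \<bar>c\<bar>"] e False by auto
    have w: "(\<lambda>i. c * u i) \<in> c00"
      using u by (auto simp: c00_def supp_def intro: finite_subset[of _ "supp u"])
    have "(\<lambda>i. x i - u i) \<in> JT_bounded r p"
      using JT_bounded_diff(1)[OF assms(1,2) x, of u] u c00_subset_JT_bounded[OF assms(1,2)] by auto
    then have "JT_norm r p (\<lambda>i. c * (x i - u i)) < \<epsilon>"
      using JT_bounded_scale(2)[OF assms(1,2), of "\<lambda>i. x i - u i" c] u False
      by (simp add: field_simps)
    then show ?thesis using w by (intro bexI[of _ "\<lambda>i. c * u i"]) (auto simp: algebra_simps)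
  qed
  then show ?thesis using JT_bounded_scale(1)[OF assms(1,2) x] by (auto simp: JT_def)
qed

lemma JT_complete:
  assumes tree: "inf_branching_tree r" and p: "p \<ge> 1" and X: "\<And>n. X n \<in> JT r p"
    and cauchy: "\<And>\<epsilon>. \<epsilon> > 0 \<Longrightarrow> \<exists>N. \<forall>m\<ge>N. \<forall>n\<ge>N. JT_norm r p (\<lambda>i. X m i - X n i) < \<epsilon>"
  shows "\<exists>x\<in>JT r p. (\<lambda>n. JT_norm r p (\<lambda>i. X n i - x i)) \<longlonglongrightarrow> 0"
proof -
  have Xb: "X n \<in> JT_bounded r p" for n using X by (auto simp: JT_def)
  note db = JT_bounded_diff(1)[OF tree p]
  have "Cauchy (\<lambda>n. X n i)" for i
  proof (rule metric_CauchyI)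
    fix \<epsilon> :: real assume "\<epsilon> > 0"
    then obtain N where N: "\<And>m n. m \<ge> N \<Longrightarrow> n \<ge> N \<Longrightarrow> JT_norm r p (\<lambda>i. X m i - X n i) < \<epsilon>"
      using cauchy by blast
    have "dist (X m i) (X n i) < \<epsilon>" if "m \<ge> N" "n \<ge> N" for m n
      using JT_norm_coord[OF tree p db[OF Xb[of m] Xb[of n]], of i] N[OF that] by (simp add: dist_real_def)
    then show "\<exists>N. \<forall>m\<ge>N. \<forall>n\<ge>N. dist (X m i) (X n i) < \<epsilon>" by blast
  qed
  then have "\<forall>i. \<exists>l. (\<lambda>n. X n i) \<longlonglongrightarrow> l"
    by (simp add: Cauchy_convergent_iff convergent_def)
  from choice[OF this] obtain x where x: "\<And>i. (\<lambda>n. X n i) \<longlonglongrightarrow> x i" by blast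
  have lim: "\<exists>N. \<forall>m\<ge>N. (\<lambda>i. X m i - x i) \<in> JT_bounded r p \<and> JT_norm r p (\<lambda>i. X m i - x i) \<le> \<epsilon>"
    if e: "\<epsilon> > 0" for \<epsilon>
  proof -
    obtain N where N: "\<And>m n. m \<ge> N \<Longrightarrow> n \<ge> N \<Longrightarrow> JT_norm r p (\<lambda>i. X m i - X n i) < \<epsilon>"
      using cauchy[OF e] by blast
    have "(\<lambda>i. X m i - x i) \<in> JT_bounded r p \<and> JT_norm r p (\<lambda>i. X m i - x i) \<le> \<epsilon>"
      if m: "m \<ge> N" for m
    proof -
      have "JT_sum p S (\<lambda>i. X m i - x i) \<le> \<epsilon>" if S: "S \<in> disjoint_segments r" for S
      proof (rule Lim_bounded)
        have l: "(\<lambda>n. L2_set (\<lambda>i. X m i - X n i) s) \<longlonglongrightarrow> L2_set (\<lambda>i. X m i - x i) s" for s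
          unfolding L2_set_def
          by (intro tendsto_real_sqrt tendsto_sum tendsto_power tendsto_diff tendsto_const x)
        have "(\<lambda>n. L2_set (\<lambda>i. X m i - X n i) s powr p) \<longlonglongrightarrow> L2_set (\<lambda>i. X m i - x i) s powr p" for s
          using p by (intro tendsto_powr'[OF l tendsto_const]) simp
        then have "(\<lambda>n. \<Sum>s\<in>S. L2_set (\<lambda>i. X m i - X n i) s powr p)
            \<longlonglongrightarrow> (\<Sum>s\<in>S. L2_set (\<lambda>i. X m i - x i) s powr p)"
          by (rule tendsto_sum)
        then show "(\<lambda>n. JT_sum p S (\<lambda>i. X m i - X n i)) \<longlonglongrightarrow> JT_sum p S (\<lambda>i. X m i - x i)"
          unfolding JT_sum_alt
          using p by (intro tendsto_powr'[OF _ tendsto_const]) (simp_all add: sum_nonneg)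
        show "\<forall>n\<ge>N. JT_sum p S (\<lambda>i. X m i - X n i) \<le> \<epsilon>"
          using JT_sum_le_norm[OF db[OF Xb[of m] Xb] S] N[OF m] by (meson less_imp_le order_trans)
      qed
      from JT_norm_le[OF tree this] show ?thesis by blast
    qed
    then show ?thesis by blast
  qed
  obtain m0 where m0: "(\<lambda>i. X m0 i - x i) \<in> JT_bounded r p" using lim[OF zero_less_one] by blast
  have xb: "x \<in> JT_bounded r p" using db[OF Xb[of m0] m0] by simp
  have "\<exists>y\<in>c00. JT_norm r p (\<lambda>i. x i - y i) < \<epsilon>" if e: "\<epsilon> > 0" for \<epsilon>
  proof -
    have e2: "\<epsilon> / 2 > 0" using e by simp
    obtain m where m: "(\<lambda>i. X m i - x i) \<in> JT_bounded r p" "JT_norm r p (\<lambda>i. X m i - x i) \<le> \<epsilon> / 2"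
      using lim[OF e2] by blast
    obtain y where y: "y \<in> c00" "JT_norm r p (\<lambda>i. X m i - y i) < \<epsilon> / 2"
      using c00_dense_JT[OF X e2] by blast
    have yb: "y \<in> JT_bounded r p" using c00_subset_JT_bounded[OF tree p] y by blast
    have "JT_norm r p (\<lambda>i. x i - y i) < \<epsilon>"
      using JT_bounded_diff(2)[OF tree p db[OF Xb[of m] yb] m(1)] m(2) y(2) by simp
    then show ?thesis using y(1) by blast
  qed
  then have "x \<in> JT r p" using xb by (simp add: JT_def)
  moreover have "(\<lambda>n. JT_norm r p (\<lambda>i. X n i - x i)) \<longlonglongrightarrow> 0"
  proof (rule LIMSEQ_I)
    fix \<epsilon> :: real assume e: "\<epsilon> > 0"
    obtain N where N: "\<And>m. m \<ge> N \<Longrightarrow> JT_norm r p (\<lambda>i. X m i - x i) \<le> \<epsilon> / 2"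
      using lim[of "\<epsilon> / 2"] e half_gt_zero[OF e] by blast
    have "norm (JT_norm r p (\<lambda>i. X n i - x i) - 0) < \<epsilon>" if "n \<ge> N" for n
      using N[OF that] JT_norm_coord[OF tree p db[OF Xb[of n] xb], of 0] e by simp
    then show "\<exists>N. \<forall>n\<ge>N. norm (JT_norm r p (\<lambda>i. X n i - x i) - 0) < \<epsilon>" by blast
  qed
  ultimately show ?thesis by blast
qed

end

theory Submission
  imports Defs "HOL-Library.Ramsey"
begin

text \<open>
  The lower \<open>\<ell>\<^sub>p\<close> estimate with constant \<open>1\<close> holds for every normalized block sequence, since
  segments can be cut down to the intervals spanned by the supports.  For the upper estimate, one
  passes to a subsequence along which no segment carries a non-negligible part of two blocks after
  the first block that it meets.  Up to small errors every segment then sees at most two blocks,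
  the first and one more, and \<open>(u + v) powr p \<le> 2 powr (p - 1) * (u powr p + v powr p)\<close> gives the
  constant \<open>2 powr (1 - 1 / p) + \<epsilon>\<close>.  The errors are summable because only finitely
  many disjoint segments meet a given block first, and the thresholds are chosen small relative to
  that number.
\<close>

section \<open>Numerical estimates\<close>

lemma sum_half_powers_le:
  assumes "finite L" "L \<subseteq> {k<..}"
  shows "(\<Sum>l\<in>L. (1 / 2 :: real) ^ l) \<le> (1 / 2) ^ k"
proof -
  obtain m where m: "L \<subseteq> {k<..k + m}"
  proof
    show "L \<subseteq> {k<..k + Max L}"
      using assms by (fastforce intro: trans_le_add2)
  qed
  have eq: "(\<Sum>l\<in>{k<..k + m}. (1 / 2 :: real) ^ l) = (1 / 2) ^ k - (1 / 2) ^ (k + m)" for m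
  proof (induction m)
    case (Suc m)
    have "{k<..k + Suc m} = insert (Suc (k + m)) {k<..k + m}" by auto
    then show ?case using Suc by simp
  qed simp
  have "(\<Sum>l\<in>L. (1 / 2 :: real) ^ l) \<le> (\<Sum>l\<in>{k<..k + m}. (1 / 2) ^ l)"
    using m by (intro sum_mono2) auto
  moreover have "0 \<le> (1 / 2 :: real) ^ (k + m)" by simp
  ultimately show ?thesis using eq[of m] by linarith
qed

text \<open>The bound for a pair depends on its smaller index, so elements are added from the
  largest downward. A new minimum \<open>n\<close> is compared with the current exception
  \<open>l\<close>: the smaller of \<open>b n\<close> and \<open>b l\<close> is at most
  \<open>d n\<close>, and the larger becomes the exception. Thus each \<open>d n\<close> pays for at
  most one term.\<close>

lemma sum_minus_one_le:
  fixes b d :: "nat \<Rightarrow> real"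
  assumes "finite L" "\<And>l m. l \<in> L \<Longrightarrow> m \<in> L \<Longrightarrow> l < m \<Longrightarrow> min (b l) (b m) \<le> d l"
    and "\<And>l. l \<in> L \<Longrightarrow> 0 \<le> d l"
  shows "\<exists>l. sum b (L - {l}) \<le> sum d L"
  using assms
proof (induction L rule: finite_linorder_min_induct)
  case (insert n L)
  then obtain l where l: "sum b (L - {l}) \<le> sum d L" by blast
  have n: "n \<notin> L" using insert.hyps by blast
  show ?case
  proof (cases "l \<in> L \<and> b n \<le> b l")
    case True
    then have "n < l" using insert.hyps by auto
    then have "b n \<le> d n" using insert.prems(1)[of n l] True by auto
    moreover have "insert n L - {l} = insert n (L - {l})" using \<open>n < l\<close> by auto
    ultimately have "sum b (insert n L - {l}) \<le> sum d (insert n L)"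
      using n l insert.hyps by simp
    then show ?thesis by blast
  next
    case False
    \<comment> \<open>Here \<open>n\<close> becomes the exception, so \<open>d n\<close> has to pay
      for the old one; if \<open>l\<close> lies outside \<open>L\<close> there is nothing to
      pay.\<close>
    have "sum b L \<le> sum b (L - {l}) + d n"
    proof (cases "l \<in> L")
      case True
      then have "n < l" using insert.hyps by auto
      then have "b l \<le> d n" using insert.prems(1)[of n l] True False by auto
      then show ?thesis using True insert.hyps by (simp add: sum.remove)
    next
      case False
      then show ?thesis using insert.prems(2)[of n] by simp
    qed
    moreover have "insert n L - {n} = L" using n by auto
    ultimately have "sum b (insert n L - {n}) \<le> sum d (insert n L)"
      using n l insert.hyps by simp
    then show ?thesis by blast
  qed
qed simp

text \<open>Convexity of the \<open>p\<close>-th power at the midpoint. After the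
  \<open>p\<close>-th root is taken, the factor becomes \<open>2 powr (1 - 1 / p)\<close>.\<close>

lemma powr_add_le:
  fixes u v p :: real
  assumes "p \<ge> 1" "u \<ge> 0" "v \<ge> 0"
  shows "(u + v) powr p \<le> 2 powr (p - 1) * (u powr p + v powr p)"
proof -
  have "((u + v) / 2) powr p \<le> (u powr p + v powr p) / 2"
    using powr_convex_comb[OF assms, of "1 / 2"] by (simp add: add_divide_distrib)
  then have "(u + v) powr p \<le> 2 powr p * ((u powr p + v powr p) / 2)"
    using assms by (simp add: powr_divide field_simps)
  then show ?thesis by (simp add: powr_diff)
qed

lemma powr_sum_card_2_le:
  fixes c :: "'a \<Rightarrow> real"
  assumes "p \<ge> 1" "\<And>n. c n \<ge> 0" "G \<subseteq> {k, l}"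
  shows "(\<Sum>n\<in>G. c n) powr p \<le> 2 powr (p - 1) * (\<Sum>n\<in>G. c n powr p)"
proof -
  have 1: "1 \<le> 2 powr (p - 1)" using assms(1) ge_one_powr_ge_zero by simp
  then have single: "c n powr p \<le> 2 powr (p - 1) * c n powr p" for n
    using mult_right_mono[of 1 _ "c n powr p"] by simp
  consider "G = {}" | "G = {k}" | "G = {l}" | "G = {k, l}" "k \<noteq> l" using assms(3) by auto
  then show ?thesis
    using single powr_add_le[OF assms(1), of "c k" "c l"] assms(1,2) by cases auto
qed

text \<open>Every term is at most the total \<open>E\<close>, so its \<open>p\<close>-th power is at
  most the term times \<open>E powr (p - 1)\<close>; summing gives \<open>E powr p\<close>.\<close>

lemma lp_le_l1:
  fixes e :: "'a \<Rightarrow> real"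
  assumes p: "p \<ge> 1" and "finite S" and e: "\<And>s. s \<in> S \<Longrightarrow> e s \<ge> 0"
  shows "(\<Sum>s\<in>S. e s powr p) powr (1 / p) \<le> (\<Sum>s\<in>S. e s)"
proof -
  define E where "E = (\<Sum>s\<in>S. e s)"
  have E: "E \<ge> 0" using e by (simp add: E_def sum_nonneg)
  have "(\<Sum>s\<in>S. e s powr p) \<le> (\<Sum>s\<in>S. e s * E powr (p - 1))"
  proof (rule sum_mono)
    fix s assume s: "s \<in> S"
    then have "e s \<le> E" unfolding E_def using assms by (intro member_le_sum) auto
    then have "e s powr (p - 1) \<le> E powr (p - 1)" using p e[OF s] by (intro powr_mono2) auto
    then show "e s powr p \<le> e s * E powr (p - 1)"
      using powr_mult_base[OF e[OF s], of "p - 1"] mult_left_mono[OF _ e[OF s]] by fastforce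
  qed
  also have "\<dots> = E powr p"
    using powr_mult_base[OF E, of "p - 1"] by (simp add: E_def flip: sum_distrib_right)
  finally have "(\<Sum>s\<in>S. e s powr p) powr (1 / p) \<le> (E powr p) powr (1 / p)"
    using p by (intro powr_mono2) (auto intro: sum_nonneg)
  then show ?thesis using p E by (simp add: powr_powr E_def)
qed

section \<open>Euclidean norms over index sets\<close>

lemma L2_set_cong_zero:
  assumes "finite A" "finite B" "\<And>i. x i \<noteq> 0 \<Longrightarrow> i \<in> A \<longleftrightarrow> i \<in> B"
  shows "L2_set x A = L2_set x B"
proof -
  have "(\<Sum>i\<in>A. (x i)\<^sup>2) = (\<Sum>i\<in>A \<inter> B. (x i)\<^sup>2)"
    using assms by (intro sum.mono_neutral_right) auto
  also have "\<dots> = (\<Sum>i\<in>B. (x i)\<^sup>2)"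
    using assms by (intro sum.mono_neutral_left) auto
  finally show ?thesis by (simp add: L2_set_def)
qed

lemma L2_set_mono_supp:
  assumes "finite B" "\<And>i. i \<in> A \<Longrightarrow> x i \<noteq> 0 \<Longrightarrow> i \<in> B"
  shows "L2_set x A \<le> L2_set x B"
\<comment> \<open>Over an infinite \<open>A\<close> the sum takes the default value 0, which leaves
  only nonnegativity to check.\<close>
proof (cases "finite A")
  case True
  have "(\<Sum>i\<in>A. (x i)\<^sup>2) = (\<Sum>i\<in>A \<inter> B. (x i)\<^sup>2)"
    using assms True by (intro sum.mono_neutral_right) auto
  also have "\<dots> \<le> (\<Sum>i\<in>B. (x i)\<^sup>2)"
    using assms by (intro sum_mono2) auto
  finally show ?thesis by (simp add: L2_set_def)
qed (simp add: L2_set_nonneg)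

lemma L2_set_nonzero_ex: "L2_set x A \<noteq> 0 \<Longrightarrow> \<exists>i\<in>A. x i \<noteq> 0"
  by (meson L2_set_0')

lemma L2_set_sum_le: "L2_set (\<lambda>i. \<Sum>n\<in>F. f n i) A \<le> (\<Sum>n\<in>F. L2_set (f n) A)"
proof (induction F rule: infinite_finite_induct)
  case (insert n F)
  have "L2_set (\<lambda>i. \<Sum>n\<in>insert n F. f n i) A = L2_set (\<lambda>i. f n i + (\<Sum>n\<in>F. f n i)) A"
    using insert by simp
  also have "\<dots> \<le> L2_set (f n) A + L2_set (\<lambda>i. \<Sum>n\<in>F. f n i) A"
    by (rule L2_set_triangle_ineq)
  finally show ?case using insert by simp
qed (auto simp: L2_set_def)

lemma L2_set_scale: "L2_set (\<lambda>i. c * x i) A = \<bar>c\<bar> * L2_set x A"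
  by (simp add: L2_set_def power_mult_distrib sum_distrib_left[symmetric] real_sqrt_mult)

section \<open>Trees\<close>

locale tree_order =
  fixes r :: "nat rel"
  assumes tree: "inf_branching_tree r"
begin

abbreviation prec (infix \<open>\<preceq>\<close> 50) where "m \<preceq> n \<equiv> (m, n) \<in> r"

lemma prec_refl [simp]: "n \<preceq> n"
  using tree by (auto simp: inf_branching_tree_def partial_order_on_def preorder_on_def refl_on_def)

lemma prec_trans [trans]: "k \<preceq> m \<Longrightarrow> m \<preceq> n \<Longrightarrow> k \<preceq> n"
  using tree unfolding inf_branching_tree_def partial_order_on_def preorder_on_def
  by (meson transD)

lemma prec_le: "m \<preceq> n \<Longrightarrow> m \<le> n"
  using tree by (auto simp: inf_branching_tree_def)

lemma prec_linear: "k \<preceq> n \<Longrightarrow> m \<preceq> n \<Longrightarrow> k \<preceq> m \<or> m \<preceq> k"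
  using tree unfolding inf_branching_tree_def Chains_def by blast

lemma prec_if_le: "k \<preceq> n \<Longrightarrow> m \<preceq> n \<Longrightarrow> k \<le> m \<Longrightarrow> k \<preceq> m"
  using prec_linear[of k n m] prec_le[of m k] by auto

definition seg :: "nat \<Rightarrow> nat \<Rightarrow> nat set" where
  "seg m n = {k. m \<preceq> k \<and> k \<preceq> n}"

definition preds :: "nat \<Rightarrow> nat set" where
  "preds n = {k. k \<preceq> n}"

lemma segments_eq: "segments r = {seg m n | m n. m \<preceq> n}"
  by (simp add: segments_def seg_def)

lemma seg_in_segments: "m \<preceq> n \<Longrightarrow> seg m n \<in> segments r"
  by (auto simp: segments_eq)

lemma finite_seg: "finite (seg m n)"
  by (rule finite_subset[of _ "{..n}"]) (auto simp: seg_def prec_le)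

lemma finite_preds: "finite (preds n)"
  by (rule finite_subset[of _ "{..n}"]) (auto simp: preds_def prec_le)

text \<open>The predecessors form a finite chain, so the numerically least one lies below all others
  and serves as the lower end of a segment.\<close>

lemma preds_in_segments: "preds n \<in> segments r"
proof -
  define m where "m = Min (preds n)"
  have ne: "preds n \<noteq> {}" using prec_refl by (auto simp: preds_def simp del: prec_refl)
  have m: "m \<preceq> n" using Min_in[OF finite_preds ne] by (simp add: m_def preds_def)
  have "m \<preceq> k" if "k \<preceq> n" for k
    using prec_if_le[OF m that] Min_le[OF finite_preds, of k n] that by (simp add: m_def preds_def)
  then have "preds n = seg m n" by (auto simp: preds_def seg_def)
  with m show ?thesis by (simp add: seg_in_segments)
qed

text \<open>On a segment the tree order agrees with the usual order, so what survives the cut is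
  exactly the segment from its least to its greatest element.\<close>

lemma segment_Int_interval:
  assumes s: "s \<in> segments r" and ne: "s \<inter> {a..b} \<noteq> {}"
  shows "s \<inter> {a..b} \<in> segments r"
proof -
  obtain m n where mn: "s = seg m n" "m \<preceq> n" using s by (auto simp: segments_eq)
  define m' n' where "m' = Min (s \<inter> {a..b})" and "n' = Max (s \<inter> {a..b})"
  have fin: "finite (s \<inter> {a..b})" by simp
  have m': "m' \<in> s \<inter> {a..b}" and n': "n' \<in> s \<inter> {a..b}"
    using Min_in[OF fin ne] Max_in[OF fin ne] by (simp_all add: m'_def n'_def)
  have mem: "k \<preceq> n" "m \<preceq> k" if "k \<in> s" for k using that mn by (auto simp: seg_def)
  have "s \<inter> {a..b} = seg m' n'"
  proof (intro equalityI subsetI)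
    fix k assume k: "k \<in> s \<inter> {a..b}"
    have "m' \<le> k" "k \<le> n'" using k fin by (simp_all add: m'_def n'_def)
    then show "k \<in> seg m' n'"
      using k m' n' prec_if_le[OF mem(1) mem(1), of m' k] prec_if_le[OF mem(1) mem(1), of k n']
      by (simp add: seg_def)
  next
    fix k assume k: "k \<in> seg m' n'"
    then have "k \<in> s" using m' n' mn by (auto simp: seg_def intro: prec_trans)
    moreover have "m' \<le> k" "k \<le> n'" using k by (auto simp: seg_def prec_le)
    ultimately show "k \<in> s \<inter> {a..b}" using m' n' by auto
  qed
  moreover have "m' \<preceq> n'"
    using prec_if_le[of m' n n'] m' n' mem Min_le[OF fin, of n'] by (auto simp: m'_def)
  ultimately show ?thesis by (simp add: seg_in_segments)
qed

text \<open>Zorn's lemma for the chains containing \<open>\<tau>\<close>: a union of nested chains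
  is again a chain, since any two of its points already lie in one member.\<close>

lemma chain_subset_branch:
  assumes "\<tau> \<in> Chains r"
  shows "\<exists>\<sigma>\<in>branches r. \<tau> \<subseteq> \<sigma>"
proof -
  let ?A = "{\<sigma> \<in> Chains r. \<tau> \<subseteq> \<sigma>}"
  have "\<exists>M\<in>?A. \<forall>X\<in>?A. M \<subseteq> X \<longrightarrow> X = M"
  proof (rule subset_Zorn_nonempty)
    show "?A \<noteq> {}" using assms by auto
    fix C assume ne: "C \<noteq> {}" and C: "subset.chain ?A C"
    have "(a, b) \<in> r \<or> (b, a) \<in> r" if ab: "a \<in> \<Union>C" "b \<in> \<Union>C" for a b
    proof -
      obtain X Y where XY: "X \<in> C" "Y \<in> C" "a \<in> X" "b \<in> Y" using ab by auto
      then have "X \<subseteq> Y \<or> Y \<subseteq> X" "X \<in> Chains r" "Y \<in> Chains r"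
        using C by (auto simp: subset_chain_def)
      then show ?thesis using XY unfolding Chains_def by blast
    qed
    moreover obtain X where "X \<in> C" "\<tau> \<subseteq> X" using ne C by (auto simp: subset_chain_def)
    ultimately show "\<Union>C \<in> ?A" by (auto simp: Chains_def)
  qed
  then obtain \<sigma> where \<sigma>: "\<sigma> \<in> Chains r" "\<tau> \<subseteq> \<sigma>"
    and max: "\<forall>X\<in>?A. \<sigma> \<subseteq> X \<longrightarrow> X = \<sigma>" by blast
  have "X = \<sigma>" if "X \<in> Chains r" "\<sigma> \<subseteq> X" for X
    using max that \<sigma>(2) by blast
  then have "\<sigma> \<in> branches r" using \<sigma>(1) unfolding branches_def by blast
  then show ?thesis using \<sigma>(2) by blast
qed

end

text \<open>Sequential compactness of a product of finite sets, without extracting the diagonal.\<close>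

lemma finite_values_cluster:
  fixes g :: "nat \<Rightarrow> nat \<Rightarrow> 'b"
  assumes "infinite Y" "\<And>i. finite (range (\<lambda>m. g m i))"
  shows "\<exists>v. \<forall>n. infinite {m \<in> Y. \<forall>i<n. g m i = v i}"
proof -
  \<comment> \<open>By the pigeonhole principle \<open>Z (Suc n)\<close> freezes coordinate
    \<open>n\<close>, so on \<open>Z n\<close> precisely the coordinates below \<open>n\<close> have
    been fixed.\<close>
  have "\<exists>Z. \<forall>n. (infinite (Z n) \<and> Z n \<subseteq> Y) \<and>
      (Z (Suc n) \<subseteq> Z n \<and> (\<exists>b. \<forall>m\<in>Z (Suc n). g m n = b))"
  proof (rule dependent_nat_choice)
    show "\<exists>Z. infinite Z \<and> Z \<subseteq> Y" using assms(1) by blast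
    fix Z n assume Z: "infinite Z \<and> Z \<subseteq> Y"
    have "finite ((\<lambda>m. g m n) ` Z)" using assms(2)[of n] by (rule rev_finite_subset) auto
    then obtain m0 where "infinite {m \<in> Z. g m n = g m0 n}"
      using pigeonhole_infinite[of Z "\<lambda>m. g m n"] Z by auto
    then show "\<exists>Z'. (infinite Z' \<and> Z' \<subseteq> Y) \<and> (Z' \<subseteq> Z \<and> (\<exists>b. \<forall>m\<in>Z'. g m n = b))"
      using Z by (intro exI[of _ "{m \<in> Z. g m n = g m0 n}"]) auto
  qed
  then obtain Z where Z: "\<And>n. infinite (Z n)" "\<And>n. Z n \<subseteq> Y" "\<And>n. Z (Suc n) \<subseteq> Z n"
    and "\<forall>n. \<exists>b. \<forall>m\<in>Z (Suc n). g m n = b" by metis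
  then obtain v where v: "\<And>n m. m \<in> Z (Suc n) \<Longrightarrow> g m n = v n" by metis
  have "Z n \<subseteq> {m \<in> Y. \<forall>i<n. g m i = v i}" for n
  proof -
    have "Z n \<subseteq> Z (Suc i)" if "i < n" for i
      using lift_Suc_antimono_le[of Z "Suc i" n] Z(3) that by simp
    then show ?thesis using v Z(2) by blast
  qed
  then show ?thesis using Z(1) by (meson infinite_super)
qed

section \<open>Normalized block sequences\<close>

text \<open>The block condition ranges over all pairs \<open>m < n\<close> instead of neighbours, so
  that it passes to subsequences directly.\<close>

locale normalized_blocks = tree_order +
  fixes p :: real and x :: "nat \<Rightarrow> nat \<Rightarrow> real"
  assumes p: "p \<ge> 1"
    and fin_supp: "finite (supp (x n))"
    and blocks: "m < n \<Longrightarrow> i \<in> supp (x m) \<Longrightarrow> j \<in> supp (x n) \<Longrightarrow> i < j"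
    and normalized: "JT_norm r p (x n) = 1"
begin

lemma bounded: "x n \<in> JT_bounded r p"
  using c00_subset_JT_bounded[OF tree p] fin_supp by (auto simp: c00_def)

lemma supp_nonempty: "supp (x n) \<noteq> {}"
proof
  assume "supp (x n) = {}"
  then have "x n = (\<lambda>i. 0)" by (auto simp: supp_def)
  then show False using normalized[of n] JT_norm_zero[OF tree p] by simp
qed

lemma sum_segments_le_1:
  assumes S: "S \<subseteq> segments r" "finite S" "disjoint S"
  shows "(\<Sum>s\<in>S. L2_set (x n) s powr p) \<le> 1"
\<comment> \<open>The empty family is not admissible in the norm and is treated apart.\<close>
proof (cases "S = {}")
  case False
  have "JT_sum p S (x n) \<le> 1"
    using JT_sum_le_norm[OF bounded, of S] S False normalized by (simp add: disjoint_segments_def)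
  then have "JT_sum p S (x n) powr p \<le> 1 powr p"
    using p by (intro powr_mono2) (auto simp: JT_sum_nonneg)
  then show ?thesis using p by (simp add: JT_sum_alt powr_powr sum_nonneg)
qed simp

text \<open>The points where a segment coming from below \<open>a\<close> and carrying at least \<open>\<delta>\<close> of \<open>x n\<close>
  enters \<open>{a..}\<close>.\<close>

definition entries :: "real \<Rightarrow> nat \<Rightarrow> nat \<Rightarrow> nat set" where
  "entries \<delta> a n = {c. a \<le> c \<and> (\<forall>k. k \<preceq> c \<longrightarrow> k \<noteq> c \<longrightarrow> k < a) \<and>
     (\<exists>b. c \<preceq> b \<and> \<delta> \<le> L2_set (x n) (seg c b))}"

text \<open>Two distinct entry points are incomparable, since the lower one would have to be below
  \<open>a\<close>. The segments starting at them are therefore disjoint, and each takes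
  \<open>\<delta> powr p\<close> out of a total of at most 1. The bound depends neither on
  \<open>a\<close> nor on \<open>n\<close>; having it for all finite subsets also gives
  finiteness.\<close>

lemma entries_card:
  assumes "\<delta> > 0"
  shows "finite (entries \<delta> a n)" "card (entries \<delta> a n) \<le> nat \<lfloor>\<delta> powr - p\<rfloor>"
proof -
  have "card G \<le> nat \<lfloor>\<delta> powr - p\<rfloor>" if G: "G \<subseteq> entries \<delta> a n" "finite G" for G
  proof -
    have "\<forall>c\<in>G. \<exists>b. c \<preceq> b \<and> \<delta> \<le> L2_set (x n) (seg c b)" using G by (auto simp: entries_def)
    then obtain b where b: "\<And>c. c \<in> G \<Longrightarrow> c \<preceq> b c \<and> \<delta> \<le> L2_set (x n) (seg c (b c))"
      by metis
    let ?t = "\<lambda>c. seg c (b c)"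
    have eq: "c = c'" if cc: "c \<in> G" "c' \<in> G" "z \<in> ?t c" "z \<in> ?t c'" for c c' z
    proof (rule ccontr)
      assume "c \<noteq> c'"
      moreover have "c \<preceq> c' \<or> c' \<preceq> c" using cc prec_linear by (auto simp: seg_def)
      moreover have "c \<in> entries \<delta> a n" "c' \<in> entries \<delta> a n" using cc G by auto
      ultimately show False by (auto simp: entries_def)
    qed
    have self: "c \<in> ?t c" if "c \<in> G" for c using b[OF that] by (simp add: seg_def)
    have inj: "inj_on ?t G" using eq self by (intro inj_onI) metis
    have "disjoint (?t ` G)" using eq by (fastforce simp: disjoint_def)
    then have "(\<Sum>s\<in>?t ` G. L2_set (x n) s powr p) \<le> 1"
      using G b by (intro sum_segments_le_1) (auto intro: seg_in_segments)
    then have "(\<Sum>c\<in>G. L2_set (x n) (?t c) powr p) \<le> 1" by (simp add: sum.reindex[OF inj])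
    moreover have "(\<Sum>c\<in>G. \<delta> powr p) \<le> (\<Sum>c\<in>G. L2_set (x n) (?t c) powr p)"
      using b assms p by (intro sum_mono powr_mono2) auto
    ultimately have "card G * \<delta> powr p \<le> 1" by simp
    then have "card G \<le> \<delta> powr - p" using assms by (simp add: powr_minus field_simps)
    then show ?thesis by linarith
  qed
  from finite_if_finite_subsets_card_bdd[OF this]
  show "finite (entries \<delta> a n)" "card (entries \<delta> a n) \<le> nat \<lfloor>\<delta> powr - p\<rfloor>" by auto
qed

section \<open>Segments carrying a large part of two blocks\<close>

definition thin :: "real \<Rightarrow> nat set \<Rightarrow> bool" where
  "thin \<delta> Y \<longleftrightarrow> (\<forall>l\<in>Y. \<forall>m\<in>Y. l < m \<longrightarrow>
     (\<forall>s\<in>segments r. min (L2_set (x l) s) (L2_set (x m) s) < \<delta>))"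

text \<open>The witness is the first node \<open>c\<close> of \<open>s\<close> that is at least
  \<open>a\<close>, the start of the support of \<open>x m\<close>. The support of
  \<open>x l\<close> ends before \<open>a\<close>, so its part on \<open>s\<close> lies among the
  predecessors of \<open>c\<close>, while the part of \<open>x m\<close> on \<open>s\<close> lies
  from \<open>c\<close> onward.\<close>

lemma entry_ex:
  assumes "\<delta> > 0" "l < m" "s \<in> segments r" "\<delta> \<le> L2_set (x l) s" "\<delta> \<le> L2_set (x m) s"
  shows "\<exists>c\<in>entries \<delta> (Min (supp (x m))) m. \<delta> \<le> L2_set (x l) (preds c)"
proof -
  define a where "a = Min (supp (x m))"
  have a: "a \<le> j" if "x m j \<noteq> 0" for j
    using that fin_supp by (simp add: a_def supp_def)
  have below: "i < a" if "x l i \<noteq> 0" for i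
    using blocks[OF assms(2), of i a] that Min_in[OF fin_supp supp_nonempty]
    by (simp add: a_def supp_def)
  obtain u n where s: "s = seg u n" "u \<preceq> n" using assms(3) by (auto simp: segments_eq)
  obtain i where i: "i \<in> s" "x l i \<noteq> 0" using L2_set_nonzero_ex[of "x l" s] assms by auto
  obtain j where j: "j \<in> s" "x m j \<noteq> 0" using L2_set_nonzero_ex[of "x m" s] assms by auto
  have fin: "finite (s \<inter> {a..})" using s finite_seg by simp
  have ne: "s \<inter> {a..} \<noteq> {}" using j a by auto
  define c where "c = Min (s \<inter> {a..})"
  have c: "c \<in> s" "a \<le> c" using Min_in[OF fin ne] by (auto simp: c_def)
  have cmin: "c \<le> k" if "k \<in> s" "a \<le> k" for k
    using that fin by (simp add: c_def)
  have cn: "u \<preceq> c" "c \<preceq> n" using c s by (auto simp: seg_def)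
  have sub: "k \<in> preds c" if "k \<in> s" "k < a" for k
    using that c cn s prec_if_le[of k n c] by (auto simp: preds_def seg_def)
  have up: "k \<in> seg c n" if "k \<in> s" "a \<le> k" for k
    using that cmin[OF that] cn s prec_if_le[of c n k] by (auto simp: seg_def)
  \<comment> \<open>Such a \<open>k\<close> either lies in \<open>s\<close>, where \<open>c\<close>
    is minimal, or below the first node \<open>u\<close> of \<open>s\<close>; and
    \<open>u \<le> i < a\<close> because \<open>s\<close> meets the support of \<open>x l\<close> at
    \<open>i\<close>.\<close>
  have "k < a" if k: "k \<preceq> c" "k \<noteq> c" for k
  proof (cases "u \<preceq> k")
    case True
    then have "k \<in> s" using k cn s by (auto simp: seg_def intro: prec_trans)
    then show ?thesis using cmin[of k] prec_le[OF k(1)] k(2) by force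
  next
    case False
    then have "k \<preceq> u" using prec_linear[OF k(1) cn(1)] by auto
    moreover have "u \<le> i" using i s by (auto simp: seg_def prec_le)
    ultimately show ?thesis using below[OF i(2)] prec_le by fastforce
  qed
  moreover have "\<delta> \<le> L2_set (x m) (seg c n)"
    using assms(5) L2_set_mono_supp[OF finite_seg, of s "x m" c n] a up by fastforce
  ultimately have "c \<in> entries \<delta> a m" using c cn by (auto simp: entries_def)
  moreover have "\<delta> \<le> L2_set (x l) (preds c)"
    using assms(4) L2_set_mono_supp[OF finite_preds, of s "x l" c] below sub by fastforce
  ultimately show ?thesis by (auto simp: a_def)
qed

text \<open>By Ramsey's theorem the only obstruction is an infinite set of indices any two of which see
  a common segment. Along it the bounded number of entry points subconverges to finitely many
  chains, one of which carries at least \<open>\<delta>\<close> of each block.\<close>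

lemma thin_subset:
  assumes branch: "\<And>\<sigma>. \<sigma> \<in> branches r \<Longrightarrow> (\<lambda>n. JT_norm r p (restr (x n) \<sigma>)) \<longlonglongrightarrow> 0"
    and \<delta>: "\<delta> > 0" and Y: "infinite Y"
  shows "\<exists>Z\<subseteq>Y. infinite Z \<and> thin \<delta> Z"
proof -
  define good where "good l m \<longleftrightarrow> (\<forall>s\<in>segments r. min (L2_set (x l) s) (L2_set (x m) s) < \<delta>)" for l m
  \<comment> \<open>Ramsey's theorem colours unordered pairs; \<open>Min\<close> and
    \<open>Max\<close> recover the order of the two indices.\<close>
  define f where "f X = (if good (Min X) (Max X) then 0 else 1 :: nat)" for X
  have "\<exists>Z t. Z \<subseteq> Y \<and> infinite Z \<and> t < 2 \<and> (\<forall>l\<in>Z. \<forall>m\<in>Z. l \<noteq> m \<longrightarrow> f {l, m} = t)"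
    by (rule Ramsey2[OF Y]) (auto simp: f_def)
  then obtain Z t where Z: "Z \<subseteq> Y" "infinite Z" "\<forall>l\<in>Z. \<forall>m\<in>Z. l \<noteq> m \<longrightarrow> f {l, m} = t"
    by (elim exE conjE) (rule that)
  have f: "f {l, m} = (if good l m then 0 else 1)" if "l < m" for l m
    using that by (simp add: f_def)
  show ?thesis
  proof (cases "\<forall>l\<in>Z. \<forall>m\<in>Z. l < m \<longrightarrow> good l m")
    case True
    then show ?thesis using Z by (auto simp: thin_def good_def)
  next
    case False
    then obtain l0 m0 where "l0 \<in> Z" "m0 \<in> Z" "l0 < m0" "\<not> good l0 m0" by blast
    then have "t = 1" using Z(3) f[of l0 m0] by fastforce
    then have bad: "\<not> good l m" if "l \<in> Z" "m \<in> Z" "l < m" for l m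
      using Z(3) f[of l m] that by (fastforce split: if_splits)
    define K where "K = nat \<lfloor>\<delta> powr - p\<rfloor>"
    \<comment> \<open>The entry points are labelled by \<open>j < K\<close> with the same
      \<open>K\<close> for every \<open>m\<close>. Surplus labels may carry arbitrary nodes: below,
      only the linear order of the predecessors of \<open>c m j\<close> is used to obtain
      chains.\<close>
    have "\<exists>c. entries \<delta> (Min (supp (x m))) m \<subseteq> c ` {..<K}" for m
    proof -
      note e = entries_card[OF \<delta>, of "Min (supp (x m))" m]
      obtain c where "bij_betw c {0..<card (entries \<delta> (Min (supp (x m))) m)}
          (entries \<delta> (Min (supp (x m))) m)"
        using ex_bij_betw_nat_finite[OF e(1)] by blast
      then show ?thesis using e(2) unfolding bij_betw_def K_def
        by (intro exI[of _ c]) fastforce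
    qed
    then obtain c where c: "\<And>m. entries \<delta> (Min (supp (x m))) m \<subseteq> c m ` {..<K}" by metis
    \<comment> \<open>\<open>g m i\<close> records which labelled nodes lie above \<open>i\<close>.
      It is a subset of \<open>{..<K}\<close>, so it takes finitely many values and a cluster point
      \<open>v\<close> exists along \<open>Z\<close>.\<close>
    define g where "g m i = {j. j < K \<and> i \<preceq> c m j}" for m i
    have "finite (range (\<lambda>m. g m i))" for i
      by (rule finite_subset[of _ "Pow {..<K}"]) (auto simp: g_def)
    from finite_values_cluster[of Z g, OF Z(2) this] obtain v
      where v: "\<And>n. infinite {m \<in> Z. \<forall>i<n. g m i = v i}" by blast
    have large: "\<exists>m\<in>Z. l < m \<and> (\<forall>i<n. g m i = v i)" for l n
      using v[of n] unfolding infinite_nat_iff_unbounded by blast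
    \<comment> \<open>\<open>\<tau> j\<close> is the limit of the predecessor sets of
      \<open>c m j\<close>. Any two of its points lie below a common \<open>c m j\<close>, which
      makes it a chain.\<close>
    define \<tau> where "\<tau> j = {i. j \<in> v i}" for j
    have "\<tau> j \<in> Chains r" for j
      unfolding Chains_def
    proof (intro CollectI ballI)
      fix i i' assume ii: "i \<in> \<tau> j" "i' \<in> \<tau> j"
      obtain m where "\<forall>k<Suc (max i i'). g m k = v k" using large by blast
      then have "g m i = v i" "g m i' = v i'" by auto
      then have "i \<preceq> c m j" "i' \<preceq> c m j" using ii by (auto simp: \<tau>_def g_def)
      then show "i \<preceq> i' \<or> i' \<preceq> i" by (rule prec_linear)
    qed
    then have "\<forall>j. \<exists>\<sigma>. \<sigma> \<in> branches r \<and> \<tau> j \<subseteq> \<sigma>"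
      using chain_subset_branch by blast
    then obtain \<sigma> where \<sigma>: "\<And>j. \<sigma> j \<in> branches r" "\<And>j. \<tau> j \<subseteq> \<sigma> j"
      by metis
    have ge: "\<exists>j<K. \<delta> \<le> JT_norm r p (restr (x l) (\<sigma> j))" if l: "l \<in> Z" for l
    proof -
      \<comment> \<open>With \<open>m\<close> far enough out, \<open>g m\<close> agrees with
        \<open>v\<close> on the whole support of \<open>x l\<close>, so the predecessors of the
        entry point that matter for \<open>x l\<close> lie in the limit chain.\<close>
      obtain m where m: "m \<in> Z" "l < m" and agree: "\<forall>i<Suc (Max (supp (x l))). g m i = v i"
        using large by blast
      obtain s where s: "s \<in> segments r" "\<delta> \<le> L2_set (x l) s" "\<delta> \<le> L2_set (x m) s"
        using bad[OF l m] by (auto simp: good_def not_less)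
      obtain c' where c': "c' \<in> entries \<delta> (Min (supp (x m))) m" "\<delta> \<le> L2_set (x l) (preds c')"
        using entry_ex[OF \<delta> m(2) s] by blast
      then obtain j where j: "j < K" "c' = c m j" using c[of m] by auto
      have in\<sigma>: "i \<in> \<sigma> j" if "i \<in> preds c'" "x l i \<noteq> 0" for i
      proof -
        have "i \<le> Max (supp (x l))" using that fin_supp by (simp add: supp_def)
        then have "g m i = v i" using agree by simp
        moreover have "j \<in> g m i" using that j by (simp add: g_def preds_def)
        ultimately show ?thesis using \<sigma>(2) by (auto simp: \<tau>_def)
      qed
      have "L2_set (x l) (preds c') = L2_set (restr (x l) (\<sigma> j)) (preds c')"
        using in\<sigma> by (intro L2_set_cong refl) (auto simp: restr_def)
      also have "\<dots> = JT_sum p {preds c'} (restr (x l) (\<sigma> j))"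
        using p by (simp add: JT_sum_alt powr_powr L2_set_nonneg)
      also have "\<dots> \<le> JT_norm r p (restr (x l) (\<sigma> j))"
      proof (rule JT_sum_le_norm)
        have "supp (restr (x l) (\<sigma> j)) \<subseteq> supp (x l)" by (auto simp: supp_def restr_def)
        then have "restr (x l) (\<sigma> j) \<in> c00"
          using fin_supp by (auto simp: c00_def intro: finite_subset)
        then show "restr (x l) (\<sigma> j) \<in> JT_bounded r p"
          using c00_subset_JT_bounded[OF tree p] by auto
        show "{preds c'} \<in> disjoint_segments r"
          using preds_in_segments by (simp add: disjoint_segments_def)
      qed
      finally show ?thesis using c' j by auto
    qed
    \<comment> \<open>Only \<open>K\<close> branches occur, so the restricted norms are eventually
      below \<open>\<delta>\<close> on all of them at once, against \<open>ge\<close>.\<close>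
    have "\<forall>j\<in>{..<K}. \<forall>\<^sub>F l in sequentially. JT_norm r p (restr (x l) (\<sigma> j)) < \<delta>"
      using order_tendstoD(2)[OF branch[OF \<sigma>(1)] \<delta>] by blast
    then have "\<forall>\<^sub>F l in sequentially. \<forall>j\<in>{..<K}. JT_norm r p (restr (x l) (\<sigma> j)) < \<delta>"
      by (simp add: eventually_ball_finite)
    then obtain L where L: "\<And>l j. l \<ge> L \<Longrightarrow> j < K \<Longrightarrow> JT_norm r p (restr (x l) (\<sigma> j)) < \<delta>"
      by (auto simp: eventually_sequentially)
    obtain l where "l \<in> Z" "l > L" using Z(2) unfolding infinite_nat_iff_unbounded by blast
    then show ?thesis using ge[of l] L[of l] by force
  qed
qed


text \<open>The threshold for the pair \<open>f l\<close>, \<open>f m\<close> depends on the earlier choices \<open>f k\<close>, so the thin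
  subsets are nested and diagonalised.\<close>

lemma diagonal_subsequence:
  fixes \<delta> :: "nat \<Rightarrow> nat \<Rightarrow> real"
  assumes branch: "\<And>\<sigma>. \<sigma> \<in> branches r \<Longrightarrow> (\<lambda>n. JT_norm r p (restr (x n) \<sigma>)) \<longlonglongrightarrow> 0"
    and \<delta>: "\<And>k n. \<delta> k n > 0"
  shows "\<exists>f. strict_mono f \<and> (\<forall>k l m. k < l \<longrightarrow> l < m \<longrightarrow> (\<forall>s\<in>segments r.
    min (L2_set (x (f l)) s) (L2_set (x (f m)) s) < \<delta> k (f k)))"
proof -
  \<comment> \<open>A state is a pair: the index chosen at stage \<open>k\<close>, and the infinite
    reservoir from which all later indices are taken, thin for the threshold fixed by that
    choice.\<close>
  define P where "P k z \<longleftrightarrow> infinite (snd z) \<and> snd z \<subseteq> {fst z<..} \<and> thin (\<delta> k (fst z)) (snd z)"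
    for k :: nat and z :: "nat \<times> nat set"
  define Q where "Q z z' \<longleftrightarrow> fst z' \<in> snd z \<and> snd z' \<subseteq> snd z" for z z' :: "nat \<times> nat set"
  have ex: "\<exists>Z. P k (m, Z) \<and> Z \<subseteq> Y" if Y: "infinite Y" for k m Y
  proof -
    have "{m<..} \<inter> Y = Y - {..m}" by auto
    then have "infinite ({m<..} \<inter> Y)" using Y by simp
    from thin_subset[OF branch \<delta>[of k m] this] show ?thesis by (force simp: P_def)
  qed
  have "\<exists>z. \<forall>k. P k (z k) \<and> Q (z k) (z (Suc k))"
  proof (rule dependent_nat_choice)
    show "\<exists>z. P 0 z" using ex[of UNIV] by auto
    fix z k assume z: "P k z"
    then have inf: "infinite (snd z)" by (simp add: P_def)
    then have "snd z \<noteq> {}" by auto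
    then obtain m where m: "m \<in> snd z" by blast
    obtain Z where "P (Suc k) (m, Z)" "Z \<subseteq> snd z" using ex[OF inf, of "Suc k" m] by blast
    then show "\<exists>z'. P (Suc k) z' \<and> Q z z'" using m by (intro exI[of _ "(m, Z)"]) (simp add: Q_def)
  qed
  then obtain z where z: "\<And>k. P k (z k)" "\<And>k. Q (z k) (z (Suc k))" by blast
  define f where "f k = fst (z k)" for k
  have sub: "snd (z l) \<subseteq> snd (z k)" if "k \<le> l" for k l
    using lift_Suc_antimono_le[of "\<lambda>k. snd (z k)" k l] z(2) that by (auto simp: Q_def)
  have mem: "f l \<in> snd (z k)" if "k < l" for k l
  proof -
    have "f l \<in> snd (z (l - 1))" using z(2)[of "l - 1"] that by (simp add: f_def Q_def)
    moreover have "k \<le> l - 1" using that by simp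
    ultimately show ?thesis using sub by blast
  qed
  have mono: "strict_mono f"
  proof (rule strict_monoI)
    fix k l :: nat assume "k < l"
    then show "f k < f l" using mem[of k l] z(1)[of k] unfolding P_def f_def by blast
  qed
  have "min (L2_set (x (f l)) s) (L2_set (x (f m)) s) < \<delta> k (f k)"
    if "k < l" "l < m" "s \<in> segments r" for k l m s
    using z(1)[of k] mem[of k l] mem[of k m] that strict_monoD[OF mono that(2)]
    by (auto simp: P_def thin_def f_def)
  then show ?thesis using mono by blast
qed

lemma subsequence: "strict_mono f \<Longrightarrow> normalized_blocks r p (\<lambda>k. x (f k))"
  by unfold_locales (use p fin_supp blocks normalized strict_monoD in blast)+


end

section \<open>The two estimates\<close>

text \<open>It bounds the number of disjoint segments that can meet the support, and thanks to
  \<open>Suc\<close> it is positive and can stand in a denominator.\<close>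

definition top_supp :: "(nat \<Rightarrow> real) \<Rightarrow> nat" where
  "top_supp y = Suc (Max (supp y))"

text \<open>Choosing a point below \<open>n\<close> in each set is injective by
  disjointness.\<close>

lemma card_disjoint_meeting_le:
  fixes S :: "nat set set"
  assumes "disjoint S" "\<And>s. s \<in> S \<Longrightarrow> s \<inter> {..<n} \<noteq> {}"
  shows "card S \<le> n"
proof -
  have "\<forall>s\<in>S. \<exists>i. i \<in> s \<inter> {..<n}" using assms(2) by blast
  then obtain h where h: "\<And>s. s \<in> S \<Longrightarrow> h s \<in> s \<inter> {..<n}" by metis
  have "inj_on h S"
    using h assms(1) by (intro inj_onI) (metis IntE disjointD disjoint_iff)
  then have "card S \<le> card {..<n}" using h by (intro card_inj_on_le) auto
  then show ?thesis by simp
qed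

context normalized_blocks
begin

lemma lt_top_supp: "x n i \<noteq> 0 \<Longrightarrow> i < top_supp (x n)"
  using fin_supp by (simp add: top_supp_def supp_def less_Suc_eq_le)

lemma top_supp_mono: "m \<le> n \<Longrightarrow> top_supp (x m) \<le> top_supp (x n)"
  using blocks[of m n "Max (supp (x m))" "Max (supp (x n))"]
    Max_in[OF fin_supp supp_nonempty] by (cases "m = n") (auto simp: top_supp_def)

text \<open>Families nearly norming the single blocks are cut to the intervals \<open>I n\<close>
  and merged. The intervals are disjoint, so the merged family is admissible; on \<open>I n\<close>
  the combination equals \<open>a n * x n\<close>, hence the \<open>p\<close>-th powers add
  up.\<close>

lemma lower_estimate:
  assumes a: "a \<in> c00"
  shows "(\<Sum>n\<in>supp a. \<bar>a n\<bar> powr p) powr (1 / p) \<le> JT_norm r p (lincomb a x)"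
proof (cases "supp a = {}")
  case True
  then show ?thesis using JT_norm_zero[OF tree p] by (simp add: lincomb_def)
next
  case False
  define F where "F = supp a"
  have F: "finite F" "F \<noteq> {}" using a False by (auto simp: F_def c00_def)
  define y where "y = lincomb a x"
  define I where "I n = {Min (supp (x n))..Max (supp (x n))}" for n
  have I: "i \<in> I n" if "x n i \<noteq> 0" for n i
    using that fin_supp by (simp add: I_def supp_def)
  have Idisj: "i \<notin> I n" if "i \<in> I m" "m \<noteq> n" for i m n
  proof -
    have "Max (supp (x l)) < Min (supp (x l'))" if "l < l'" for l l'
      using blocks[OF that] Max_in[OF fin_supp supp_nonempty] Min_in[OF fin_supp supp_nonempty] by blast
    from this[of m n] this[of n m] show ?thesis using that by (auto simp: I_def neq_iff)
  qed
  have ya: "y i = a n * x n i" if "n \<in> F" "i \<in> I n" for n i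
  proof -
    have "a m * x m i = 0" if "m \<noteq> n" for m
      using I[of m i] Idisj[OF \<open>i \<in> I n\<close>, of m] that by auto
    then have "(\<Sum>m\<in>F. a m * x m i) = (\<Sum>m\<in>{n}. a m * x m i)"
      using F that by (intro sum.mono_neutral_right) auto
    then show ?thesis by (simp add: y_def lincomb_def F_def)
  qed
  have "supp y \<subseteq> (\<Union>n\<in>F. supp (x n))"
  proof
    fix i assume "i \<in> supp y"
    then have "(\<Sum>n\<in>F. a n * x n i) \<noteq> 0" by (simp add: supp_def y_def lincomb_def F_def)
    then obtain n where "n \<in> F" "a n * x n i \<noteq> 0"
      by (rule sum.not_neutral_contains_not_neutral)
    then show "i \<in> (\<Union>n\<in>F. supp (x n))" by (auto simp: supp_def)
  qed
  then have "y \<in> c00" using F fin_supp by (auto simp: c00_def intro: finite_subset)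
  then have yb: "y \<in> JT_bounded r p" using c00_subset_JT_bounded[OF tree p] by auto
  define W where "W = (\<Sum>n\<in>F. \<bar>a n\<bar> powr p)"
  have W: "W \<ge> 0" by (simp add: W_def sum_nonneg)
  \<comment> \<open>Every \<open>t < 1\<close> is exceeded by some family because the supremum is 1;
    letting \<open>t\<close> tend to 1 avoids asking whether it is attained.\<close>
  have "t * W powr (1 / p) \<le> JT_norm r p y" if t: "0 < t" "t < 1" for t
  proof -
    have "\<exists>S\<in>disjoint_segments r. t < JT_sum p S (x n)" for n
      using t normalized[of n] bounded[of n] singleton_disjoint_segments[OF tree]
      unfolding JT_norm_def JT_bounded_def by (subst less_cSUP_iff[symmetric]) auto
    then obtain S where S: "\<And>n. S n \<in> disjoint_segments r" "\<And>n. t < JT_sum p (S n) (x n)" by metis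
    note S' = S(1)[unfolded disjoint_segments_def, simplified]
    \<comment> \<open>Segments missing \<open>I n\<close> are dropped, since their trace would be
      empty and hence no segment; on the others, taking traces is injective by disjointness.\<close>
    define U where "U n = {s \<in> S n. s \<inter> I n \<noteq> {}}" for n
    define T where "T n = (\<lambda>s. s \<inter> I n) ` U n" for n
    have finT: "finite (T n)" for n using S' by (simp add: T_def U_def)
    have Tsum: "t powr p \<le> (\<Sum>s\<in>T n. L2_set (x n) s powr p)" for n
    proof -
      have "inj_on (\<lambda>s. s \<inter> I n) (U n)"
      proof (rule inj_onI)
        fix s s' assume "s \<in> U n" "s' \<in> U n" "s \<inter> I n = s' \<inter> I n"
        moreover have "disjoint (S n)" using S' by blast
        ultimately show "s = s'" by (auto simp: U_def disjoint_def)
      qed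
      then have "(\<Sum>s\<in>T n. L2_set (x n) s powr p) = (\<Sum>s\<in>U n. L2_set (x n) (s \<inter> I n) powr p)"
        by (simp add: T_def sum.reindex)
      also have "\<dots> = (\<Sum>s\<in>U n. L2_set (x n) s powr p)"
      proof (intro sum.cong refl arg_cong[of _ _ "\<lambda>u. u powr p"] L2_set_cong_zero)
        fix s assume "s \<in> U n"
        then show "finite s" using finite_segment[OF tree] S' by (auto simp: U_def)
      qed (use I in \<open>auto simp: I_def\<close>)
      also have "\<dots> = (\<Sum>s\<in>S n. L2_set (x n) s powr p)"
      proof (rule sum.mono_neutral_left)
        have "L2_set (x n) s = 0" if "s \<inter> I n = {}" for s
          using L2_set_nonzero_ex[of "x n" s] I that by blast
        then show "\<forall>s\<in>S n - U n. L2_set (x n) s powr p = 0" by (auto simp: U_def)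
      qed (use S' in \<open>auto simp: U_def\<close>)
      also have "\<dots> = JT_sum p (S n) (x n) powr p"
        using p by (simp add: JT_sum_alt powr_powr sum_nonneg)
      finally show ?thesis using S(2)[of n] t p by (simp add: powr_mono2)
    qed
    have Tne: "s \<noteq> {} \<and> s \<subseteq> I n" if "s \<in> T n" for n s using that by (auto simp: T_def U_def)
    have dis: "disjoint (T n)" for n
    proof -
      have "disjoint (S n)" using S' by blast
      then show ?thesis unfolding T_def U_def disjoint_def by blast
    qed
    define V where "V = (\<Union>n\<in>F. T n)"
    have "V \<in> disjoint_segments r"
    proof -
      have "T n \<noteq> {}" for n using Tsum[of n] t by auto
      then have "V \<noteq> {}" using F by (simp add: V_def)
      moreover have "finite V" using F finT by (simp add: V_def)
      moreover have "V \<subseteq> segments r"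
      proof
        fix s assume "s \<in> V"
        then obtain n s' where "s = s' \<inter> I n" "s' \<in> S n" "s' \<inter> I n \<noteq> {}"
          by (auto simp: V_def T_def U_def)
        then show "s \<in> segments r"
          using segment_Int_interval[of s'] S' unfolding I_def by blast
      qed
      moreover have "disjoint V"
        unfolding disjoint_def
      proof (intro ballI impI)
        fix s s' assume ss: "s \<in> V" "s' \<in> V" "s \<noteq> s'"
        then obtain m n where mn: "s \<in> T m" "s' \<in> T n" by (auto simp: V_def)
        show "s \<inter> s' = {}"
        proof (cases "m = n")
          case True
          then show ?thesis using dis[of n] ss mn by (auto simp: disjoint_def)
        next
          case False
          then show ?thesis using Tne mn Idisj by blast
        qed
      qed
      ultimately show ?thesis by (simp add: disjoint_segments_def)
    qed
    then have le: "JT_sum p V y \<le> JT_norm r p y" by (rule JT_sum_le_norm[OF yb])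
    have "t powr p * W = (\<Sum>n\<in>F. \<bar>a n\<bar> powr p * t powr p)"
      by (simp add: W_def sum_distrib_left mult.commute)
    also have "\<dots> \<le> (\<Sum>n\<in>F. \<bar>a n\<bar> powr p * (\<Sum>s\<in>T n. L2_set (x n) s powr p))"
      using Tsum by (intro sum_mono mult_left_mono) auto
    also have "\<dots> = (\<Sum>n\<in>F. \<Sum>s\<in>T n. L2_set y s powr p)"
    proof (rule sum.cong[OF refl])
      fix n assume n: "n \<in> F"
      have "L2_set y s = \<bar>a n\<bar> * L2_set (x n) s" if "s \<in> T n" for s
      proof -
        have "L2_set y s = L2_set (\<lambda>i. a n * x n i) s"
          using ya[OF n] Tne[OF that] by (intro L2_set_cong) auto
        then show ?thesis by (simp add: L2_set_scale)
      qed
      then show "\<bar>a n\<bar> powr p * (\<Sum>s\<in>T n. L2_set (x n) s powr p) = (\<Sum>s\<in>T n. L2_set y s powr p)"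
        by (simp add: sum_distrib_left powr_mult)
    qed
    also have "\<dots> = (\<Sum>s\<in>V. L2_set y s powr p)"
    proof -
      have "T m \<inter> T n = {}" if "m \<noteq> n" for m n using Tne Idisj[OF _ that] by blast
      then show ?thesis unfolding V_def using F finT by (intro sum.UNION_disjoint[symmetric]) auto
    qed
    finally have "(t powr p * W) powr (1 / p) \<le> JT_sum p V y"
      unfolding JT_sum_alt using p W by (intro powr_mono2) auto
    moreover have "(t powr p * W) powr (1 / p) = t * W powr (1 / p)"
      using p W t by (simp add: powr_mult powr_powr)
    ultimately show ?thesis using le by simp
  qed
  then have "W powr (1 / p) \<le> JT_norm r p y" by (rule field_le_mult_one_interval)
  then show ?thesis by (simp add: W_def F_def y_def)
qed

text \<open>Let \<open>k\<close> be the first block that \<open>s\<close> meets. Among the later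
  blocks all but one, \<open>l\<close>, are small in total by \<open>sum_minus_one_le\<close>. The
  blocks \<open>k\<close> and \<open>l\<close> make up \<open>u\<close>, at the cost of
  \<open>2 powr (p - 1)\<close>; the rest is the error.\<close>

lemma segment_estimate:
  assumes gap: "\<And>k l m. k < l \<Longrightarrow> l < m \<Longrightarrow>
      min (L2_set (x l) s) (L2_set (x m) s) < \<epsilon> / (2 ^ (k + 2) * top_supp (x k))"
    and \<epsilon>: "\<epsilon> > 0" and F: "finite F" "\<And>n. n \<in> F \<Longrightarrow> \<bar>a n\<bar> \<le> \<Lambda>" "\<Lambda> \<ge> 0"
    and ne: "{n \<in> F. L2_set (x n) s \<noteq> 0} \<noteq> {}"
    and k: "k = Min {n \<in> F. L2_set (x n) s \<noteq> 0}"
  shows "\<exists>u\<ge>0. u powr p \<le> 2 powr (p - 1) * (\<Sum>n\<in>F. \<bar>a n\<bar> powr p * L2_set (x n) s powr p) \<and>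
    (\<Sum>n\<in>F. \<bar>a n\<bar> * L2_set (x n) s) \<le> u + \<Lambda> * (\<epsilon> / (2 ^ (k + 1) * top_supp (x k)))"
proof -
  define b where "b n = L2_set (x n) s" for n
  define F' where "F' = {n \<in> F. b n \<noteq> 0}"
  have b: "b n \<ge> 0" for n by (simp add: b_def)
  have F': "finite F'" "F' \<noteq> {}" "F' \<subseteq> F" using F ne by (auto simp: F'_def b_def)
  have k': "k = Min F'" using k by (simp add: F'_def b_def)
  then have kF: "k \<in> F'" and kmin: "\<And>n. n \<in> F' \<Longrightarrow> k \<le> n" using F' by auto
  define L where "L = F' - {k}"
  have L: "finite L" "\<And>l. l \<in> L \<Longrightarrow> k < l" using F' kmin by (force simp: L_def)+
  \<comment> \<open>This is \<open>gap\<close> at the index \<open>l - 1\<close>, which is at least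
    \<open>k\<close> for \<open>l\<close> in \<open>L\<close>. Hence its denominator contains at
    least \<open>top_supp (x k)\<close>, and the powers of two sum over \<open>l > k\<close> to at
    most \<open>1 / 2 ^ (k + 1)\<close>.\<close>
  define d where "d l = \<epsilon> / (2 ^ (l + 1) * top_supp (x (l - 1)))" for l
  have d0: "d l \<ge> 0" for l using \<epsilon> by (simp add: d_def)
  have "min (b l) (b m) \<le> d l" if "l \<in> L" "m \<in> L" "l < m" for l m
    using gap[of "l - 1" l m] L(2)[OF that(1)] that(3) by (simp add: b_def d_def)
  then obtain l where l: "sum b (L - {l}) \<le> sum d L"
    using sum_minus_one_le[OF L(1), of b d] d0 by blast
  have "sum d L \<le> (\<Sum>j\<in>L. \<epsilon> / (2 * top_supp (x k)) * (1 / 2) ^ j)"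
  proof (rule sum_mono)
    fix j assume "j \<in> L"
    then have "top_supp (x k) \<le> top_supp (x (j - 1))" using L(2)[of j] by (intro top_supp_mono) simp
    moreover have "top_supp (x k) > 0" by (simp add: top_supp_def)
    ultimately have "d j \<le> \<epsilon> / (2 ^ (j + 1) * top_supp (x k))"
      unfolding d_def using \<epsilon> by (intro divide_left_mono mult_left_mono mult_pos_pos) auto
    then show "d j \<le> \<epsilon> / (2 * top_supp (x k)) * (1 / 2) ^ j"
      by (simp add: power_one_over field_simps)
  qed
  also have "\<dots> \<le> \<epsilon> / (2 * top_supp (x k)) * (1 / 2) ^ k"
    unfolding sum_distrib_left[symmetric] using \<epsilon> L
    by (intro mult_left_mono sum_half_powers_le) auto
  finally have dL: "sum d L \<le> \<epsilon> / (2 ^ (k + 1) * top_supp (x k))"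
    by (simp add: power_one_over field_simps)
  \<comment> \<open>The exception \<open>l\<close> may lie outside \<open>F'\<close>, hence the
    intersection.\<close>
  define G where "G = F' \<inter> {k, l}"
  define u where "u = (\<Sum>n\<in>G. \<bar>a n\<bar> * b n)"
  have "u powr p \<le> 2 powr (p - 1) * (\<Sum>n\<in>G. (\<bar>a n\<bar> * b n) powr p)"
    unfolding u_def using p b by (intro powr_sum_card_2_le[of _ _ _ k l]) (auto simp: G_def)
  also have "\<dots> \<le> 2 powr (p - 1) * (\<Sum>n\<in>F. (\<bar>a n\<bar> * b n) powr p)"
    using F' F by (intro mult_left_mono sum_mono2) (auto simp: G_def)
  finally have u: "u powr p \<le> 2 powr (p - 1) * (\<Sum>n\<in>F. \<bar>a n\<bar> powr p * b n powr p)"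
    using b by (simp add: powr_mult)
  have "(\<Sum>n\<in>F. \<bar>a n\<bar> * b n) = (\<Sum>n\<in>F'. \<bar>a n\<bar> * b n)"
    using F by (intro sum.mono_neutral_right) (auto simp: F'_def)
  also have "F' = G \<union> (L - {l})" using kF by (auto simp: G_def L_def)
  also have "(\<Sum>n\<in>G \<union> (L - {l}). \<bar>a n\<bar> * b n) = u + (\<Sum>n\<in>L - {l}. \<bar>a n\<bar> * b n)"
    unfolding u_def using F' L by (intro sum.union_disjoint) (auto simp: G_def L_def)
  also have "(\<Sum>n\<in>L - {l}. \<bar>a n\<bar> * b n) \<le> (\<Sum>n\<in>L - {l}. \<Lambda> * b n)"
    using F F' b by (intro sum_mono mult_right_mono) (auto simp: L_def)
  also have "\<dots> = \<Lambda> * sum b (L - {l})" by (simp add: sum_distrib_left)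
  also have "\<dots> \<le> \<Lambda> * (\<epsilon> / (2 ^ (k + 1) * top_supp (x k)))"
    using l dL F by (intro mult_left_mono) auto
  finally have "(\<Sum>n\<in>F. \<bar>a n\<bar> * b n) \<le> u + \<Lambda> * (\<epsilon> / (2 ^ (k + 1) * top_supp (x k)))" by simp
  moreover have "u \<ge> 0" using b by (simp add: u_def sum_nonneg)
  ultimately show ?thesis using u unfolding b_def by blast
qed

text \<open>Minkowski's inequality separates the main parts \<open>u\<close> from the errors
  \<open>e\<close>. For \<open>u\<close>, exchanging the sums leaves for each block a quantity at
  most 1 by \<open>sum_segments_le_1\<close>. For \<open>e\<close>, the \<open>p\<close>-norm is
  bounded by the plain sum.\<close>

lemma upper_estimate:
  assumes gap: "\<And>k l m s. k < l \<Longrightarrow> l < m \<Longrightarrow> s \<in> segments r \<Longrightarrow>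
      min (L2_set (x l) s) (L2_set (x m) s) < \<epsilon> / (2 ^ (k + 2) * top_supp (x k))"
    and \<epsilon>: "\<epsilon> > 0" and a: "a \<in> c00"
  shows "JT_norm r p (lincomb a x)
    \<le> (2 powr (1 - 1 / p) + \<epsilon>) * (\<Sum>n\<in>supp a. \<bar>a n\<bar> powr p) powr (1 / p)"
proof (rule JT_norm_le(2)[OF tree])
  fix S assume "S \<in> disjoint_segments r"
  then have S: "finite S" "S \<subseteq> segments r" "disjoint S" by (auto simp: disjoint_segments_def)
  define F where "F = supp a"
  have F: "finite F" using a by (simp add: F_def c00_def)
  define W where "W = (\<Sum>n\<in>F. \<bar>a n\<bar> powr p)"
  define \<Lambda> where "\<Lambda> = W powr (1 / p)"
  have W: "W \<ge> 0" by (simp add: W_def sum_nonneg)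
  have \<Lambda>: "\<Lambda> \<ge> 0" by (simp add: \<Lambda>_def)
  have a\<Lambda>: "\<bar>a n\<bar> \<le> \<Lambda>" if "n \<in> F" for n
  proof -
    have "\<bar>a n\<bar> powr p \<le> W" unfolding W_def using that F by (intro member_le_sum) auto
    then have "(\<bar>a n\<bar> powr p) powr (1 / p) \<le> \<Lambda>"
      unfolding \<Lambda>_def using p by (intro powr_mono2) auto
    then show ?thesis using p by (simp add: powr_powr)
  qed
  define b where "b n s = L2_set (x n) s" for n s
  define F' where "F' s = {n \<in> F. b n s \<noteq> 0}" for s
  define \<eta> where "\<eta> k = \<Lambda> * (\<epsilon> / (2 ^ (k + 1) * top_supp (x k)))" for k
  have \<eta>: "\<eta> k \<ge> 0" for k using \<Lambda> \<epsilon> by (simp add: \<eta>_def)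
  define e where "e s = (if F' s = {} then 0 else \<eta> (Min (F' s)))" for s
  have e: "e s \<ge> 0" for s using \<eta> by (simp add: e_def)
  have "\<forall>s\<in>S. \<exists>u. 0 \<le> u \<and>
      u powr p \<le> 2 powr (p - 1) * (\<Sum>n\<in>F. \<bar>a n\<bar> powr p * b n s powr p) \<and>
      (\<Sum>n\<in>F. \<bar>a n\<bar> * b n s) \<le> u + e s" (is "\<forall>s\<in>S. \<exists>u. ?R s u")
  proof
    fix s assume s: "s \<in> S"
    show "\<exists>u. ?R s u"
    proof (cases "F' s = {}")
      case True
      then have "(\<Sum>n\<in>F. \<bar>a n\<bar> * b n s) = 0" by (intro sum.neutral) (auto simp: F'_def)
      then show ?thesis using True by (intro exI[of _ 0]) (simp add: e_def sum_nonneg)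
    next
      case False
      have "s \<in> segments r" using s S by auto
      from segment_estimate[OF gap[OF _ _ this] \<epsilon> F a\<Lambda> \<Lambda> _ refl] False
      show ?thesis by (simp add: e_def \<eta>_def F'_def b_def)
    qed
  qed
  from bchoice[OF this] obtain u where "\<forall>s\<in>S. ?R s (u s)" ..
  then have u: "\<And>s. s \<in> S \<Longrightarrow> u s \<ge> 0"
    and up: "\<And>s. s \<in> S \<Longrightarrow> u s powr p \<le> 2 powr (p - 1) * (\<Sum>n\<in>F. \<bar>a n\<bar> powr p * b n s powr p)"
    and ue: "\<And>s. s \<in> S \<Longrightarrow> (\<Sum>n\<in>F. \<bar>a n\<bar> * b n s) \<le> u s + e s"
    by simp_all
  have "L2_set (lincomb a x) s \<le> u s + e s" if "s \<in> S" for s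
  proof -
    have "L2_set (lincomb a x) s \<le> (\<Sum>n\<in>F. L2_set (\<lambda>i. a n * x n i) s)"
      unfolding lincomb_def F_def by (rule L2_set_sum_le)
    then show ?thesis using ue[OF that] by (simp add: L2_set_scale b_def)
  qed
  then have "JT_sum p S (lincomb a x) \<le> (\<Sum>s\<in>S. (u s + e s) powr p) powr (1 / p)"
    unfolding JT_sum_alt using p by (intro powr_mono2 sum_mono) (auto intro: sum_nonneg)
  also have "\<dots> \<le> (\<Sum>s\<in>S. u s powr p) powr (1 / p) + (\<Sum>s\<in>S. e s powr p) powr (1 / p)"
    using p S u e by (intro minkowski_powr) auto
  also have "(\<Sum>s\<in>S. u s powr p) powr (1 / p) \<le> 2 powr (1 - 1 / p) * \<Lambda>"
  proof -
    have "(\<Sum>s\<in>S. u s powr p) \<le> (\<Sum>s\<in>S. 2 powr (p - 1) * (\<Sum>n\<in>F. \<bar>a n\<bar> powr p * b n s powr p))"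
      using up by (rule sum_mono)
    also have "\<dots> = 2 powr (p - 1) * (\<Sum>n\<in>F. \<bar>a n\<bar> powr p * (\<Sum>s\<in>S. b n s powr p))"
      unfolding sum_distrib_left by (rule sum.swap)
    also have "\<dots> \<le> 2 powr (p - 1) * (\<Sum>n\<in>F. \<bar>a n\<bar> powr p * 1)"
      unfolding b_def using sum_segments_le_1[OF S(2,1,3)]
      by (intro mult_left_mono sum_mono) auto
    finally have "(\<Sum>s\<in>S. u s powr p) powr (1 / p) \<le> (2 powr (p - 1) * W) powr (1 / p)"
      using p by (intro powr_mono2) (auto simp: W_def intro: sum_nonneg)
    also have "\<dots> = 2 powr (1 - 1 / p) * \<Lambda>"
      using p W by (simp add: powr_mult powr_powr \<Lambda>_def diff_divide_distrib)
    finally show ?thesis .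
  qed
  also have "(\<Sum>s\<in>S. e s powr p) powr (1 / p) \<le> \<epsilon> * \<Lambda>"
  proof -
    define S' where "S' = {s \<in> S. F' s \<noteq> {}}"
    have S': "finite S'" "disjoint S'" using S by (simp_all add: S'_def disjoint_def)
    have min: "Min (F' s) \<in> F' s" if "s \<in> S'" for s
      using that F by (intro Min_in) (auto simp: S'_def F'_def)
    have "(\<Sum>s\<in>S. e s powr p) powr (1 / p) \<le> (\<Sum>s\<in>S. e s)"
      using p S e by (intro lp_le_l1) auto
    also have "\<dots> = (\<Sum>s\<in>S'. \<eta> (Min (F' s)))"
      unfolding S'_def using S by (intro sum.mono_neutral_cong_right) (auto simp: e_def)
    \<comment> \<open>Segments are grouped by the first block they meet. The group of block
      \<open>k\<close> has at most \<open>top_supp (x k)\<close> members, which cancels the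
      denominator of \<open>\<eta> k\<close>.\<close>
    also have "\<dots> = (\<Sum>k\<in>F. \<Sum>s\<in>{s \<in> S'. Min (F' s) = k}. \<eta> (Min (F' s)))"
      using S' F min by (intro sum.group[symmetric]) (auto simp: F'_def)
    also have "\<dots> \<le> (\<Sum>k\<in>F. \<epsilon> * \<Lambda> * (1 / 2) ^ Suc k)"
    proof (rule sum_mono)
      fix k
      let ?R = "{s \<in> S'. Min (F' s) = k}"
      have "card ?R \<le> top_supp (x k)"
      proof (rule card_disjoint_meeting_le)
        show "disjoint ?R" using S'(2) by (auto simp: disjoint_def)
        fix s assume "s \<in> ?R"
        then have "L2_set (x k) s \<noteq> 0" using min[of s] by (auto simp: F'_def b_def)
        then show "s \<inter> {..<top_supp (x k)} \<noteq> {}"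
          using L2_set_nonzero_ex lt_top_supp by blast
      qed
      moreover have "top_supp (x k) * \<eta> k = \<epsilon> * \<Lambda> * (1 / 2) ^ Suc k"
      proof -
        have "top_supp (x k) > 0" by (simp add: top_supp_def)
        then show ?thesis by (simp add: \<eta>_def power_one_over field_simps)
      qed
      moreover have "(\<Sum>s\<in>?R. \<eta> (Min (F' s))) = card ?R * \<eta> k" by simp
      ultimately show "(\<Sum>s\<in>?R. \<eta> (Min (F' s))) \<le> \<epsilon> * \<Lambda> * (1 / 2) ^ Suc k"
        using \<eta>[of k] by (metis mult_right_mono of_nat_mono)
    qed
    \<comment> \<open>Shifting by \<open>Suc\<close> makes all exponents positive, so the geometric
      sum is at most 1.\<close>
    also have "\<dots> = \<epsilon> * \<Lambda> * (\<Sum>l\<in>Suc ` F. (1 / 2) ^ l)"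
      by (simp add: sum.reindex sum_distrib_left)
    also have "\<dots> \<le> \<epsilon> * \<Lambda> * (1 / 2) ^ 0"
      using F \<epsilon> \<Lambda> by (intro mult_left_mono sum_half_powers_le) auto
    finally show ?thesis by simp
  qed
  finally show "JT_sum p S (lincomb a x)
      \<le> (2 powr (1 - 1 / p) + \<epsilon>) * (\<Sum>n\<in>supp a. \<bar>a n\<bar> powr p) powr (1 / p)"
    by (simp add: distrib_right \<Lambda>_def W_def F_def)
qed

end

section \<open>Equivalence with the unit vector basis\<close>

lemma lp_norm_lincomb_unit_vec:
  assumes "a \<in> c00" "p \<ge> 1"
  shows "lp_norm p (lincomb a unit_vec) = (\<Sum>n\<in>supp a. \<bar>a n\<bar> powr p) powr (1 / p)"
proof -
  have fin: "finite (supp a)" using assms by (simp add: c00_def)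
  have "lincomb a unit_vec i = (\<Sum>n\<in>supp a. if n = i then a n else 0)" for i
    unfolding lincomb_def unit_vec_def by (intro sum.cong) auto
  then have "lincomb a unit_vec = a" using fin by (auto simp: supp_def)
  moreover have "(\<Sum>i. \<bar>a i\<bar> powr p) = (\<Sum>n\<in>supp a. \<bar>a n\<bar> powr p)"
    using fin by (intro suminf_finite) (auto simp: supp_def)
  ultimately show ?thesis by (simp add: lp_norm_def)
qed

theorem theorem1p2p1:
  fixes r :: "nat rel" and p q :: real and x :: "nat \<Rightarrow> nat \<Rightarrow> real"
  assumes "inf_branching_tree r"
    and "2 < p" and "1 / p + 1 / q = 1"
    and "\<forall>n. x n \<in> JT r p"
    and "block_sequence x"
    and "\<forall>n. JT_norm r p (x n) = 1"
    and "\<forall>\<sigma>\<in>branches r. (\<lambda>n. JT_norm r p (restr (x n) \<sigma>)) \<longlonglongrightarrow> 0"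
  shows "(\<exists>f::nat \<Rightarrow> nat. strict_mono f \<and>
            equivalent_seq (JT_norm r p) (\<lambda>k. x (f k)) (lp_norm p) unit_vec) \<and>
         (\<forall>\<epsilon>>0. \<exists>f::nat \<Rightarrow> nat. strict_mono f \<and>
            C_equivalent (2 powr (1 / q) + \<epsilon>) (JT_norm r p) (\<lambda>k. x (f k)) (lp_norm p) unit_vec)"
proof -
  have fin: "finite (supp (x n))" and ne: "supp (x n) \<noteq> {}"
    and step: "Max (supp (x n)) < Min (supp (x (Suc n)))" for n
    using assms(5) by (auto simp: block_sequence_def c00_def)
  \<comment> \<open>\<open>block_sequence\<close> compares neighbours; increasing right ends of the
    supports extend the separation to all pairs.\<close>
  have "Max (supp (x n)) < Max (supp (x (Suc n)))" for n
    using step[of n] Min_le[OF fin Max_in[OF fin ne], of "Suc n"] by simp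
  then have mono: "strict_mono (\<lambda>n. Max (supp (x n)))" by (simp add: strict_mono_Suc_iff)
  interpret normalized_blocks r p x
  proof
    fix m n i j assume mn: "m < n" and ij: "i \<in> supp (x m)" "j \<in> supp (x n)"
    have "i \<le> Max (supp (x m))" using ij fin by simp
    also have "\<dots> \<le> Max (supp (x (n - 1)))"
      using strict_mono_leD[OF mono, of m "n - 1"] mn by simp
    also have "\<dots> < Min (supp (x n))" using step[of "n - 1"] mn by simp
    also have "\<dots> \<le> j" using ij fin by simp
    finally show "i < j" .
  qed (use assms fin in auto)
  have q: "1 / q = 1 - 1 / p" using assms(3) by simp
  have main: "\<exists>f::nat \<Rightarrow> nat. strict_mono f \<and>
      C_equivalent (2 powr (1 / q) + \<epsilon>) (JT_norm r p) (\<lambda>k. x (f k)) (lp_norm p) unit_vec"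
    if \<epsilon>: "\<epsilon> > 0" for \<epsilon>
  proof -
    have pos: "\<epsilon> / (2 ^ (k + 2) * top_supp (x n)) > 0" for k n
    proof -
      have "top_supp (x n) > 0" by (simp add: top_supp_def)
      then show ?thesis using \<epsilon> by simp
    qed
    have "\<exists>f. strict_mono f \<and> (\<forall>k l m. k < l \<longrightarrow> l < m \<longrightarrow> (\<forall>s\<in>segments r.
        min (L2_set (x (f l)) s) (L2_set (x (f m)) s) < \<epsilon> / (2 ^ (k + 2) * top_supp (x (f k)))))"
      using assms(7) pos
      by (intro diagonal_subsequence[where \<delta> = "\<lambda>k n. \<epsilon> / (2 ^ (k + 2) * top_supp (x n))"]) auto
    then obtain f where f: "strict_mono f" and "\<forall>k l m. k < l \<longrightarrow> l < m \<longrightarrow> (\<forall>s\<in>segments r.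
        min (L2_set (x (f l)) s) (L2_set (x (f m)) s) < \<epsilon> / (2 ^ (k + 2) * top_supp (x (f k))))"
      by (elim exE conjE) (rule that)
    then have gap: "\<And>k l m s. k < l \<Longrightarrow> l < m \<Longrightarrow> s \<in> segments r \<Longrightarrow>
        min (L2_set (x (f l)) s) (L2_set (x (f m)) s) < \<epsilon> / (2 ^ (k + 2) * top_supp (x (f k)))"
      by simp
    interpret sub: normalized_blocks r p "\<lambda>k. x (f k)" by (rule subsequence[OF f])
    have "C_equivalent (2 powr (1 / q) + \<epsilon>) (JT_norm r p) (\<lambda>k. x (f k)) (lp_norm p) unit_vec"
      unfolding C_equivalent_def
    \<comment> \<open>\<open>A = 1\<close> comes from the lower estimate and \<open>B\<close> from
      the upper one, so their product is exactly the required constant.\<close>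
    proof (rule exI[of _ 1], rule conjI, simp, rule exI[of _ "2 powr (1 / q) + \<epsilon>"], intro conjI ballI)
      fix a assume a: "a \<in> c00"
      show "inverse 1 * lp_norm p (lincomb a unit_vec) \<le> JT_norm r p (lincomb a (\<lambda>k. x (f k)))"
        using sub.lower_estimate[OF a] lp_norm_lincomb_unit_vec[OF a p] by simp
      show "JT_norm r p (lincomb a (\<lambda>k. x (f k)))
          \<le> (2 powr (1 / q) + \<epsilon>) * lp_norm p (lincomb a unit_vec)"
        using sub.upper_estimate[OF gap \<epsilon> a] lp_norm_lincomb_unit_vec[OF a p] q by simp
    qed (use \<epsilon> in \<open>auto intro: add_pos_pos\<close>)
    then show ?thesis using f by blast
  qed
  \<comment> \<open>Plain equivalence follows from the quantitative form with
    \<open>\<epsilon> = 1\<close>.\<close>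
  then show ?thesis using main[OF zero_less_one] unfolding equivalent_seq_def by blast
qed

end
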